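(* There is an absolute constant $C>0$ such that the following holds. Let $k,n,\ell$ be positive integers, let $\delta>0$, and let $V_1,V_2,\ldots,V_n\subset\mathbb{C}^\ell$ be $k$-dimensional complex linear subspaces such that $V_i\cap V_{i'}=\{\vec{0}\}$ for all $i\neq i'\in[n]$. Suppose that for every $i_1\in[n]$ there exist at least $\delta n$ values of $i_2\in[n]\setminus\{i_1\}$ such that $V_{i_1}+V_{i_2}$ contains some $V_{i_3}$ with $i_3\notin\{i_1,i_2\}$. Then $$\dim(V_1+V_2+\cdots+V_n)\leq C\,k^4/\delta^2.$$
   Context: $V+U$ denotes the subspace spanned by all vectors in $V\cup U$. The theorem's conclusion is printed in the paper as $\dim(V_1+\cdots+V_n)=O(k^4/\delta^2)$ with $O$ hiding an absolute constant. *)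

theory Defs
  imports Complex_Main "HOL-Library.Function_Algebras"
begin

text \<open>
  Since the constant in the theorem must not depend on the ambient dimension \<open>l\<close>, the
  dimension cannot be a type. Vectors are functions \<open>nat \<Rightarrow> complex\<close>, and \<open>cspace l\<close>, the
  functions supported on the first \<open>l\<close> coordinates, plays the role of complex \<open>l\<close>-space.
  Subspaces, spans and dimensions are over the complex numbers.
\<close>

definition cscale :: "complex \<Rightarrow> (nat \<Rightarrow> complex) \<Rightarrow> (nat \<Rightarrow> complex)" where
  "cscale c v = (\<lambda>i. c * v i)"

global_interpretation cvec: vector_space cscale
  by unfold_locales (simp_all add: cscale_def fun_eq_iff algebra_simps)

definition cspace :: "nat \<Rightarrow> (nat \<Rightarrow> complex) set" where
  "cspace l = {v. \<forall>i\<ge>l. v i = 0}"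

lemma subspace_cspace: "cvec.subspace (cspace l)"
  by (auto simp: cvec.subspace_def cspace_def cscale_def)

lemma dim_cspace: "cvec.dim (cspace l) = l"
proof -
  define e :: "nat \<Rightarrow> nat \<Rightarrow> complex" where "e = (\<lambda>i j. if j = i then 1 else 0)"
  have inj: "inj e"
    by (rule injI) (metis e_def zero_neq_one)
  have eval: "(\<Sum>i\<in>A. cscale (u i) (e i)) j = (if j \<in> A then u j else 0)"
    if "finite A" for A u j
    using that by (induction A rule: finite_induct) (auto simp: cscale_def e_def)
  have ind: "cvec.independent (e ` {..<l})"
  proof (rule cvec.independent_if_scalars_zero)
    fix f x assume z: "(\<Sum>x\<in>e ` {..<l}. cscale (f x) x) = 0" and x: "x \<in> e ` {..<l}"
    then obtain i where i: "i < l" "x = e i" by auto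
    have "(\<Sum>i<l. cscale (f (e i)) (e i)) = 0"
      using z inj by (simp add: sum.reindex inj_on_subset)
    from fun_cong[OF this, of i] show "f x = 0"
      using i eval[of "{..<l}" "\<lambda>i. f (e i)" i] by simp
  qed simp
  have "v \<in> cvec.span (e ` {..<l})" if "v \<in> cspace l" for v
  proof -
    have "v = (\<Sum>i<l. cscale (v i) (e i))"
      using that by (auto simp: fun_eq_iff eval cspace_def)
    also have "\<dots> \<in> cvec.span (e ` {..<l})"
      by (intro cvec.span_sum cvec.span_scale cvec.span_base) auto
    finally show ?thesis .
  qed
  then have "cspace l \<subseteq> cvec.span (e ` {..<l})" by blast
  moreover have "e ` {..<l} \<subseteq> cspace l"
    by (auto simp: e_def cspace_def)
  ultimately have "cvec.dim (cspace l) = card (e ` {..<l})"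
    using ind by (metis cvec.basis_card_eq_dim)
  also have "\<dots> = l"
    using inj by (simp add: card_image inj_on_subset)
  finally show ?thesis .
qed

end

theory Submission
  imports Defs "Jordan_Normal_Form.Schur_Decomposition" "Jordan_Normal_Form.DL_Submatrix"
    "HOL-Analysis.Function_Topology" "HOL-Analysis.L2_Norm"
begin

text \<open>
  Let \<open>X\<close> be the span of all \<open>V\<^sub>i\<close>. Among the linear maps \<open>T\<close> of \<open>X\<close> onto a space of dimension
  \<open>d > 0\<close> choose one of least slope \<open>\<sigma> = (\<Sum>\<^sub>i dim T V\<^sub>i) / d\<close>; then \<open>\<sigma> \<le> n k / dim X\<close>, and the images
  \<open>T V\<^sub>i\<close>, of dimensions \<open>k\<^sub>i \<le> k\<close>, form a semistable arrangement. Operator scaling therefore provides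
  a linear change of coordinates after which the orthogonal projections \<open>P\<^sub>i\<close> onto the \<open>T V\<^sub>i\<close> almost
  satisfy \<open>\<Sum>\<^sub>i P\<^sub>i = \<sigma> 1\<close>; in particular \<open>\<Sum>\<^sub>i\<^sub>,\<^sub>j tr(P\<^sub>i P\<^sub>j) \<le> 2 \<sigma>\<^sup>2 d\<close>, while \<open>\<Sum>\<^sub>i tr P\<^sub>i = \<sigma> d\<close>.

  The \<open>2k\<close>-dimensional spaces \<open>V\<^sub>a + V\<^sub>b\<close> behave like lines: any two of their members span them. On a
  line with \<open>r \<ge> 3\<close> members the sum \<open>Q\<close> of the projections has rank at most \<open>k\<^sub>a + k\<^sub>b\<close> for any two
  members \<open>a\<close>, \<open>b\<close>. Hence \<open>tr Q\<^sup>2 \<ge> r s / 2\<close> for \<open>s = tr Q\<close>, and the off-diagonal terms contribute at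
  least \<open>s (r - 1) / 4\<close>. Summing over all lines gives \<open>2 \<sigma>\<^sup>2 d \<ge> (\<delta> n / 4) \<sigma> d\<close>, that is
  \<open>\<sigma> \<ge> \<delta> n / 8\<close>, and so \<open>dim X \<le> 8 k / \<delta>\<close>; finally \<open>\<delta> \<le> 1 \<le> k\<close>.
\<close>

section \<open>Linear algebra in coordinate space\<close>

interpretation cpair: vector_space_pair cscale cscale ..

abbreviation clinear :: "((nat \<Rightarrow> complex) \<Rightarrow> nat \<Rightarrow> complex) \<Rightarrow> bool" where
  "clinear \<equiv> Vector_Spaces.linear cscale cscale"

abbreviation csubspace :: "nat \<Rightarrow> (nat \<Rightarrow> complex) set \<Rightarrow> bool" where
  "csubspace n W \<equiv> cvec.subspace W \<and> W \<subseteq> cspace n"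

lemma clinearI:
  assumes "\<And>x y. f (x + y) = f x + f y" "\<And>c x. f (cscale c x) = cscale c (f x)"
  shows "clinear f"
  using assms by unfold_locales auto

lemma cscale_apply [simp]: "cscale c v i = c * v i"
  by (simp add: cscale_def)

lemma sum_fun_apply: "(\<Sum>j\<in>J. f j) a = (\<Sum>j\<in>J. f j a)"
  for f :: "'j \<Rightarrow> 'a \<Rightarrow> 'b::comm_monoid_add"
  by (induction J rule: infinite_finite_induct) auto

lemma cspace_span_finite: obtains B where "finite B" "card B = l" "cspace l \<subseteq> cvec.span B"
proof -
  obtain B where B: "B \<subseteq> cspace l" "cspace l \<subseteq> cvec.span B" "card B = l"
    using cvec.basis_exists[of "cspace l"] dim_cspace by metis
  have "finite B"
  proof (cases "l = 0")
    case True
    then have "cspace l = {0}" by (auto simp: cspace_def fun_eq_iff)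
    with B(1) show ?thesis using finite_subset by auto
  next
    case False
    with B(3) show ?thesis using card_ge_0_finite by auto
  qed
  with B that show ?thesis by blast
qed

lemma cspace_finite_basis:
  assumes "S \<subseteq> cspace l"
  obtains B where "finite B" "B \<subseteq> S" "cvec.independent B" "S \<subseteq> cvec.span B" "card B = cvec.dim S"
proof -
  obtain C where C: "finite C" "cspace l \<subseteq> cvec.span C" by (rule cspace_span_finite)
  obtain B where B: "B \<subseteq> S" "cvec.independent B" "S \<subseteq> cvec.span B" "card B = cvec.dim S"
    using cvec.basis_exists[of S] by metis
  then have "B \<subseteq> cvec.span C" using assms C(2) by blast
  with C(1) B have "finite B" using cvec.independent_span_bound by blast
  with B that show ?thesis by blast
qed

lemma dim_le_cspace:
  assumes "S \<subseteq> cspace l" shows "cvec.dim S \<le> l"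
  using cspace_span_finite[of l] cvec.dim_le_card assms by (metis subset_trans)

lemma dim_mono_cspace:
  assumes "T \<subseteq> cspace l" "S \<subseteq> cvec.span T" shows "cvec.dim S \<le> cvec.dim T"
proof -
  obtain B where B: "finite B" "T \<subseteq> cvec.span B" "card B = cvec.dim T"
    using cspace_finite_basis[OF assms(1)] by metis
  have "cvec.span T \<subseteq> cvec.span B" using B(2) by (rule cvec.span_minimal) simp
  then show ?thesis using assms(2) B cvec.dim_le_card by (metis subset_trans)
qed

lemma span_cspace: "S \<subseteq> cspace l \<Longrightarrow> cvec.span S \<subseteq> cspace l"
  by (rule cvec.span_minimal) (simp_all add: subspace_cspace)

lemma subspace_eq_if_dim_le:
  assumes "cvec.subspace S" "S \<subseteq> T" "T \<subseteq> cspace l" "cvec.dim T \<le> cvec.dim S"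
  shows "S = T"
proof (rule ccontr)
  assume "S \<noteq> T"
  then obtain x where x: "x \<in> T" "x \<notin> S" using assms(2) by blast
  obtain B where B: "finite B" "B \<subseteq> S" "cvec.independent B" "S \<subseteq> cvec.span B" "card B = cvec.dim S"
    by (rule cspace_finite_basis[of S l]) (use assms in auto)
  have "x \<notin> cvec.span B" using x(2) B(2) assms(1) cvec.span_minimal by blast
  then have "x \<notin> B" using cvec.span_base by blast
  then have "card (insert x B) = Suc (cvec.dim S)" using B(1,5) by simp
  moreover have "cvec.independent (insert x B)"
    using \<open>x \<notin> cvec.span B\<close> B(3) by (rule cvec.independent_insertI)
  ultimately have "Suc (cvec.dim S) = cvec.dim (insert x B)"
    using cvec.dim_eq_card_independent by metis
  also have "\<dots> \<le> cvec.dim T"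
    using assms(2,3) x(1) B(2) by (intro dim_mono_cspace) (auto intro: cvec.span_base)
  finally show False using assms(4) by simp
qed

lemma dim_linear_image_le:
  assumes "S \<subseteq> cspace l" "clinear f" shows "cvec.dim (f ` S) \<le> cvec.dim S"
proof -
  obtain B where B: "finite B" "S \<subseteq> cvec.span B" "card B = cvec.dim S"
    using cspace_finite_basis[OF assms(1)] by metis
  have "f ` S \<subseteq> cvec.span (f ` B)" using B(2) cpair.linear_span_image[OF assms(2)] by blast
  then have "cvec.dim (f ` S) \<le> card (f ` B)" using B(1) by (intro cvec.dim_le_card) auto
  also have "\<dots> \<le> cvec.dim S" using B card_image_le by metis
  finally show ?thesis .
qed

lemma dim_linear_image_eq:
  assumes "cvec.subspace S" "clinear f" "\<And>x. x \<in> S \<Longrightarrow> f x = 0 \<Longrightarrow> x = 0"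
  shows "cvec.dim (f ` S) = cvec.dim S"
proof -
  obtain B where B: "B \<subseteq> S" "cvec.independent B" "S \<subseteq> cvec.span B" "card B = cvec.dim S"
    using cvec.basis_exists[of S] by metis
  have S: "cvec.span B = S" using cvec.span_subspace[OF B(1,3) assms(1)] .
  have inj: "inj_on f (cvec.span B)"
    unfolding S cpair.linear_inj_on_iff_eq_0[OF assms(2,1)] using assms(3) by blast
  have "cvec.independent (f ` B)"
    by (rule cpair.linear_independent_injective_image[OF assms(2) B(2) inj])
  moreover have "cvec.span (f ` B) = f ` S" using cpair.linear_span_image[OF assms(2)] S by metis
  ultimately have "cvec.dim (f ` S) = card (f ` B)" using cvec.dim_span_eq_card_independent by metis
  also have "\<dots> = card B" using inj cvec.span_superset by (intro card_image) (rule inj_on_subset)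
  finally show ?thesis using B(4) by simp
qed

lemma subspace_isomorphism_cspace:
  assumes S: "csubspace l S" and T: "csubspace m T" and dim: "cvec.dim S = cvec.dim T"
  obtains f where "clinear f" "f ` S = T" "inj_on f S"
proof -
  obtain B where B: "finite B" "B \<subseteq> S" "cvec.independent B" "S \<subseteq> cvec.span B" "card B = cvec.dim S"
    by (rule cspace_finite_basis[OF conjunct2[OF S]])
  obtain C where C: "finite C" "C \<subseteq> T" "cvec.independent C" "T \<subseteq> cvec.span C" "card C = cvec.dim T"
    by (rule cspace_finite_basis[OF conjunct2[OF T]])
  show ?thesis
    using cpair.finite_basis_to_basis_subspace_isomorphism[OF conjunct1[OF S] conjunct1[OF T] dim B(1-5) C(1-5)]
      that by blast
qed

lemma dim_Un_le:
  assumes "S \<subseteq> cspace l" "T \<subseteq> cspace l" shows "cvec.dim (S \<union> T) \<le> cvec.dim S + cvec.dim T"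
proof -
  obtain B where B: "finite B" "S \<subseteq> cvec.span B" "card B = cvec.dim S"
    using cspace_finite_basis[OF assms(1)] by metis
  obtain C where C: "finite C" "T \<subseteq> cvec.span C" "card C = cvec.dim T"
    using cspace_finite_basis[OF assms(2)] by metis
  have "S \<union> T \<subseteq> cvec.span (B \<union> C)"
    using B(2) C(2) cvec.span_mono[of B "B \<union> C"] cvec.span_mono[of C "B \<union> C"] by blast
  then have "cvec.dim (S \<union> T) \<le> card (B \<union> C)" using B C by (intro cvec.dim_le_card) auto
  then show ?thesis using B(3) C(3) card_Un_le[of B C] by simp
qed

lemma independent_Un:
  assumes "finite B" "cvec.independent B" "finite C" "cvec.independent C"
    "cvec.span B \<inter> cvec.span C = {0}"
  shows "cvec.independent (B \<union> C)" "B \<inter> C = {}"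
proof -
  show disj: "B \<inter> C = {}"
  proof (rule ccontr)
    assume "B \<inter> C \<noteq> {}"
    then obtain v where "v \<in> B" "v \<in> C" by blast
    then have "v \<in> cvec.span B \<inter> cvec.span C" by (simp add: cvec.span_base)
    then have "v = 0" using assms(5) by simp
    then show False using \<open>v \<in> B\<close> cvec.dependent_zero[of B] assms(2) by simp
  qed
  show "cvec.independent (B \<union> C)"
  proof (rule cvec.independent_if_scalars_zero)
    fix u x
    assume sum_zero: "(\<Sum>v\<in>B \<union> C. cscale (u v) v) = 0" and x: "x \<in> B \<union> C"
    define y z where "y = (\<Sum>v\<in>B. cscale (u v) v)" and "z = (\<Sum>v\<in>C. cscale (u v) v)"
    have "y + z = 0" using sum_zero disj assms(1,3) by (simp add: y_def z_def sum.union_disjoint)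
    then have neg: "z = - y" by (simp add: eq_neg_iff_add_eq_0 add.commute)
    have "y \<in> cvec.span B" "z \<in> cvec.span C"
      unfolding y_def z_def by (simp_all add: cvec.span_sum cvec.span_scale cvec.span_base)
    then have "z \<in> cvec.span B \<inter> cvec.span C" using neg cvec.span_neg by simp
    then have "z = 0" using assms(5) by simp
    then have "y = 0" using neg by simp
    note zero = \<open>y = 0\<close>[unfolded y_def] \<open>z = 0\<close>[unfolded z_def]
    then show "u x = 0"
      using x cvec.independentD[OF assms(2,1) order_refl zero(1)]
        cvec.independentD[OF assms(4,3) order_refl zero(2)] by (meson UnE)
  qed (use assms in auto)
qed

lemma dim_Un_eq_if_trivial_Int:
  assumes S: "csubspace l S" and T: "csubspace l T" and Int: "S \<inter> T = {0}"
  shows "cvec.dim (S \<union> T) = cvec.dim S + cvec.dim T"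
proof -
  obtain B where B: "finite B" "B \<subseteq> S" "cvec.independent B" "S \<subseteq> cvec.span B" "card B = cvec.dim S"
    by (rule cspace_finite_basis[OF conjunct2[OF S]])
  obtain C where C: "finite C" "C \<subseteq> T" "cvec.independent C" "T \<subseteq> cvec.span C" "card C = cvec.dim T"
    by (rule cspace_finite_basis[OF conjunct2[OF T]])
  have "cvec.span B = S" "cvec.span C = T"
    using cvec.span_subspace[OF B(2,4) conjunct1[OF S]]
      cvec.span_subspace[OF C(2,4) conjunct1[OF T]] .
  then have ind: "cvec.independent (B \<union> C)" "B \<inter> C = {}"
    using independent_Un[OF B(1,3) C(1,3)] Int by simp_all
  have "cvec.dim S + cvec.dim T = card (B \<union> C)" using B C ind(2) by (simp add: card_Un_disjoint)
  also have "\<dots> = cvec.dim (B \<union> C)" using ind(1) cvec.dim_eq_card_independent by metis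
  also have "\<dots> \<le> cvec.dim (S \<union> T)"
    using B(2) C(2) S T by (intro dim_mono_cspace) (auto intro: cvec.span_base)
  finally show ?thesis using dim_Un_le[of S l T] S T by simp
qed

section \<open>Matrices as linear maps\<close>

definition mat_apply :: "complex mat \<Rightarrow> (nat \<Rightarrow> complex) \<Rightarrow> nat \<Rightarrow> complex" where
  "mat_apply A x = (\<lambda>a. if a < dim_row A then \<Sum>b<dim_col A. A $$ (a,b) * x b else 0)"

definition unit_fun :: "nat \<Rightarrow> nat \<Rightarrow> complex" where
  "unit_fun j = (\<lambda>i. if i = j then 1 else 0)"

lemma unit_fun_in_cspace: "j < n \<Longrightarrow> unit_fun j \<in> cspace n"
  by (auto simp: unit_fun_def cspace_def)

lemma linear_mat_apply: "clinear (mat_apply A)"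
  by (rule clinearI)
    (auto simp: mat_apply_def fun_eq_iff algebra_simps sum.distrib sum_distrib_left)

lemma mat_apply_in_cspace: "A \<in> carrier_mat n m \<Longrightarrow> mat_apply A x \<in> cspace n"
  by (simp add: mat_apply_def cspace_def)

lemma mat_apply_zero [simp]: "mat_apply A 0 = 0"
  by (simp add: mat_apply_def fun_eq_iff)

lemma mat_apply_unit_fun:
  "j < dim_col A \<Longrightarrow> mat_apply A (unit_fun j) = (\<lambda>a. if a < dim_row A then A $$ (a,j) else 0)"
  by (auto simp: mat_apply_def unit_fun_def if_distrib cong: if_cong)

lemma mat_apply_one: "x \<in> cspace n \<Longrightarrow> mat_apply (1\<^sub>m n) x = x"
proof
  fix a
  assume x: "x \<in> cspace n"
  have "(\<Sum>b<n. 1\<^sub>m n $$ (a,b) * x b) = (\<Sum>b<n. if b = a then x b else 0)" if "a < n"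
    using that by (intro sum.cong) auto
  then show "mat_apply (1\<^sub>m n) x a = x a" using x by (simp add: mat_apply_def cspace_def)
qed

lemma index_mult_mat_sum:
  "i < dim_row A \<Longrightarrow> j < dim_col B \<Longrightarrow> dim_col A = dim_row B \<Longrightarrow>
    (A * B) $$ (i,j) = (\<Sum>a<dim_col A. A $$ (i,a) * B $$ (a,j))"
  by (simp add: scalar_prod_def atLeast0LessThan)

lemma mult_mat_assoc:
  "dim_col A = dim_row B \<Longrightarrow> dim_col B = dim_row C \<Longrightarrow> A * B * C = A * (B * C)"
  for A :: "'a::semiring_0 mat"
  using assoc_mult_mat[of A "dim_row A" "dim_row B" B "dim_row C" C "dim_col C"]
  by (metis carrier_matI)

lemma mat_apply_mult:
  assumes "dim_col A = dim_row B"
  shows "mat_apply (A * B) x = mat_apply A (mat_apply B x)"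
proof
  fix i
  show "mat_apply (A * B) x i = mat_apply A (mat_apply B x) i"
  proof (cases "i < dim_row A")
    case True
    have "mat_apply (A * B) x i = (\<Sum>j<dim_col B. \<Sum>a<dim_row B. A $$ (i,a) * B $$ (a,j) * x j)"
      using True assms
      by (simp add: mat_apply_def index_mult_mat_sum sum_distrib_right del: index_mult_mat(1))
    also have "\<dots> = (\<Sum>a<dim_row B. \<Sum>j<dim_col B. A $$ (i,a) * B $$ (a,j) * x j)" by (rule sum.swap)
    also have "\<dots> = mat_apply A (mat_apply B x) i"
      using True assms by (simp add: mat_apply_def sum_distrib_left mult.assoc)
    finally show ?thesis .
  qed (simp add: mat_apply_def)
qed

lemma unit_fun_expansion:
  assumes "x \<in> cspace n"
  shows "x = (\<Sum>j<n. cscale (x j) (unit_fun j))"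
proof
  fix i
  have "(\<Sum>j<n. x j * unit_fun j i) = (\<Sum>j<n. if j = i then x j else 0)"
    by (intro sum.cong) (auto simp: unit_fun_def)
  then show "x i = (\<Sum>j<n. cscale (x j) (unit_fun j)) i"
    using assms by (simp add: sum_fun_apply cspace_def)
qed

lemma cspace_eq_span_unit_fun: "cspace n = cvec.span (unit_fun ` {..<n})"
proof
  show "cspace n \<subseteq> cvec.span (unit_fun ` {..<n})"
  proof
    fix x assume "x \<in> cspace n"
    then have "x = (\<Sum>j<n. cscale (x j) (unit_fun j))" by (rule unit_fun_expansion)
    also have "\<dots> \<in> cvec.span (unit_fun ` {..<n})"
      by (intro cvec.span_sum cvec.span_scale cvec.span_base) auto
    finally show "x \<in> cvec.span (unit_fun ` {..<n})" .
  qed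
  show "cvec.span (unit_fun ` {..<n}) \<subseteq> cspace n"
    by (intro span_cspace) (auto intro: unit_fun_in_cspace)
qed

lemma matrix_of_linear:
  assumes "clinear f" "\<And>x. x \<in> cspace m \<Longrightarrow> f x \<in> cspace n"
  obtains A where "A \<in> carrier_mat n m" "\<And>x. x \<in> cspace m \<Longrightarrow> mat_apply A x = f x"
proof
  define A where "A = mat n m (\<lambda>(a,b). f (unit_fun b) a)"
  show "A \<in> carrier_mat n m" by (simp add: A_def)
  fix x assume x: "x \<in> cspace m"
  have "f x = f (\<Sum>b<m. cscale (x b) (unit_fun b))" using unit_fun_expansion[OF x] by simp
  also have "\<dots> = (\<Sum>b<m. cscale (x b) (f (unit_fun b)))"
    by (simp add: cpair.linear_sum[OF assms(1)] cpair.linear_scale[OF assms(1)])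
  finally have "f x a = mat_apply A x a" if "a < n" for a
    using that by (simp add: mat_apply_def A_def sum_fun_apply mult.commute)
  moreover have "f x a = mat_apply A x a" if "\<not> a < n" for a
    using that assms(2)[OF x] by (simp add: mat_apply_def A_def cspace_def)
  ultimately show "mat_apply A x = f x" by (intro ext) metis
qed

definition mat_range :: "complex mat \<Rightarrow> (nat \<Rightarrow> complex) set" where
  "mat_range A = mat_apply A ` cspace (dim_col A)"

lemma subspace_mat_range: "cvec.subspace (mat_range A)"
  unfolding mat_range_def by (rule cpair.linear_subspace_image[OF linear_mat_apply subspace_cspace])

lemma mat_range_subset_cspace: "mat_range A \<subseteq> cspace (dim_row A)"
  using mat_apply_in_cspace[of A "dim_row A" "dim_col A"] by (auto simp: mat_range_def)

lemma mat_range_mult: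
  assumes "dim_col A = dim_row B"
  shows "mat_range (A * B) = mat_apply A ` mat_range B"
  by (simp add: mat_range_def mat_apply_mult[OF assms] image_image)

lemma factor_if_mat_range_subset:
  assumes "mat_range A \<subseteq> mat_range B" "dim_row A = dim_row B"
  obtains R where "R \<in> carrier_mat (dim_col B) (dim_col A)" "A = B * R"
proof -
  have "\<exists>y. mat_apply A (unit_fun j) = mat_apply B y" if "j < dim_col A" for j
    using assms(1) unit_fun_in_cspace[OF that] by (auto simp: mat_range_def)
  then obtain r where r: "\<And>j. j < dim_col A \<Longrightarrow> mat_apply A (unit_fun j) = mat_apply B (r j)"
    by metis
  define R where "R = mat (dim_col B) (dim_col A) (\<lambda>(i,j). r j i)"
  have "A = B * R"
  proof (rule eq_matI)
    fix i j assume "i < dim_row (B * R)" "j < dim_col (B * R)"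
    then have ij: "i < dim_row B" "j < dim_col A" by (simp_all add: R_def)
    then have "A $$ (i,j) = mat_apply A (unit_fun j) i"
      using assms(2) by (simp add: mat_apply_unit_fun)
    also have "\<dots> = (\<Sum>b<dim_col B. B $$ (i,b) * R $$ (b,j))"
      unfolding r[OF ij(2)] using ij by (simp add: mat_apply_def R_def)
    also have "\<dots> = (B * R) $$ (i,j)"
      using ij by (intro index_mult_mat_sum[symmetric]) (simp_all add: R_def)
    finally show "A $$ (i,j) = (B * R) $$ (i,j)" .
  qed (simp_all add: R_def assms(2))
  moreover have "R \<in> carrier_mat (dim_col B) (dim_col A)" by (simp add: R_def)
  ultimately show ?thesis using that by blast
qed

lemma vec_eq_zero_iff: "x \<in> cspace n \<Longrightarrow> vec n x = 0\<^sub>v n \<longleftrightarrow> x = 0"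
  by (auto simp: vec_eq_iff cspace_def fun_eq_iff) (metis not_le)

lemma mult_mat_vec_eq_zero_iff:
  assumes A: "A \<in> carrier_mat n m"
  shows "A *\<^sub>v vec m x = 0\<^sub>v n \<longleftrightarrow> mat_apply A x = 0"
proof -
  have "A *\<^sub>v vec m x = vec n (mat_apply A x)"
    using A by (intro eq_vecI) (simp_all add: mat_apply_def scalar_prod_def atLeast0LessThan)
  then show ?thesis using vec_eq_zero_iff[OF mat_apply_in_cspace[OF A]] by simp
qed

lemma det_nonzero_iff_mat_apply_injective:
  assumes A: "A \<in> carrier_mat n n"
  shows "det A \<noteq> 0 \<longleftrightarrow> (\<forall>x\<in>cspace n. mat_apply A x = 0 \<longrightarrow> x = 0)"
proof -
  have "(\<exists>v. v \<in> carrier_vec n \<and> v \<noteq> 0\<^sub>v n \<and> A *\<^sub>v v = 0\<^sub>v n)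
      \<longleftrightarrow> (\<exists>x\<in>cspace n. x \<noteq> 0 \<and> mat_apply A x = 0)"
  proof
    assume "\<exists>v. v \<in> carrier_vec n \<and> v \<noteq> 0\<^sub>v n \<and> A *\<^sub>v v = 0\<^sub>v n"
    then obtain v where v: "v \<in> carrier_vec n" "v \<noteq> 0\<^sub>v n" "A *\<^sub>v v = 0\<^sub>v n" by blast
    define x where "x i = (if i < n then v $ i else 0)" for i
    have x: "x \<in> cspace n" "vec n x = v" using v(1) by (auto simp: x_def cspace_def)
    then show "\<exists>x\<in>cspace n. x \<noteq> 0 \<and> mat_apply A x = 0"
      using v(2,3) vec_eq_zero_iff[OF x(1)] mult_mat_vec_eq_zero_iff[OF A, of x] by auto
  next
    assume "\<exists>x\<in>cspace n. x \<noteq> 0 \<and> mat_apply A x = 0"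
    then show "\<exists>v. v \<in> carrier_vec n \<and> v \<noteq> 0\<^sub>v n \<and> A *\<^sub>v v = 0\<^sub>v n"
      using vec_eq_zero_iff mult_mat_vec_eq_zero_iff[OF A] by (metis vec_carrier)
  qed
  then show ?thesis using det_0_iff_vec_prod_zero_field[OF A] by auto
qed

section \<open>Adjoints and traces\<close>

notation mat_adjoint ("_\<^sup>\<dagger>" [1000] 999)

lemma dim_mat_adjoint [simp]: "dim_row (A\<^sup>\<dagger>) = dim_col A" "dim_col (A\<^sup>\<dagger>) = dim_row A"
  by (simp_all add: mat_adjoint_def)

lemma index_mat_adjoint [simp]:
  "i < dim_col A \<Longrightarrow> j < dim_row A \<Longrightarrow> A\<^sup>\<dagger> $$ (i,j) = cnj (A $$ (j,i))"
  by (simp add: mat_adjoint_def mat_of_rows_def conjugate_complex_def)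

lemma mat_adjoint_carrier [simp]: "A\<^sup>\<dagger> \<in> carrier_mat m n \<longleftrightarrow> A \<in> carrier_mat n m"
  by (auto intro!: carrier_matI dest: carrier_matD)

lemma mat_adjoint_adjoint [simp]: "(A\<^sup>\<dagger>)\<^sup>\<dagger> = (A :: complex mat)"
  by (intro eq_matI) auto

lemma mat_adjoint_one [simp]: "(1\<^sub>m n)\<^sup>\<dagger> = (1\<^sub>m n :: complex mat)"
  by (intro eq_matI) auto

lemma mat_adjoint_mult:
  assumes "dim_col A = dim_row B"
  shows "(A * B)\<^sup>\<dagger> = B\<^sup>\<dagger> * (A :: complex mat)\<^sup>\<dagger>"
  using assms
  by (intro eq_matI)
    (auto simp: index_mult_mat_sum mult.commute simp del: index_mult_mat(1) intro!: sum.cong)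

lemma det_mat_adjoint:
  fixes A :: "complex mat"
  assumes "A \<in> carrier_mat n n"
  shows "det (A\<^sup>\<dagger>) = cnj (det A)"
proof -
  interpret cnj: comm_ring_hom cnj by unfold_locales auto
  have "A\<^sup>\<dagger> = map_mat cnj (A\<^sup>T)" by (intro eq_matI) auto
  then show ?thesis using cnj.hom_det[of "A\<^sup>T"] det_transpose[OF assms] by simp
qed

definition trace :: "'a::comm_monoid_add mat \<Rightarrow> 'a" where
  "trace A = (\<Sum>i<dim_row A. A $$ (i,i))"

lemma trace_mult_commute:
  fixes A B :: "'a::comm_semiring_0 mat"
  assumes "dim_row A = dim_col B" "dim_col A = dim_row B"
  shows "trace (A * B) = trace (B * A)"
proof -
  have "trace (A * B) = (\<Sum>i<dim_row A. \<Sum>a<dim_col A. A $$ (i,a) * B $$ (a,i))"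
    using assms by (simp add: trace_def index_mult_mat_sum del: index_mult_mat(1))
  also have "\<dots> = (\<Sum>a<dim_col A. \<Sum>i<dim_row A. A $$ (i,a) * B $$ (a,i))" by (rule sum.swap)
  also have "\<dots> = trace (B * A)"
    using assms by (simp add: trace_def index_mult_mat_sum mult.commute del: index_mult_mat(1))
  finally show ?thesis .
qed

lemma trace_one [simp]: "trace (1\<^sub>m n) = (of_nat n :: 'a::semiring_1)"
  by (simp add: trace_def)

lemma trace_adjoint_mult:
  fixes A B :: "complex mat"
  assumes "dim_row A = dim_row B" "dim_col A = dim_col B"
  shows "trace (A\<^sup>\<dagger> * B) = (\<Sum>j<dim_col A. \<Sum>i<dim_row A. cnj (A $$ (i,j)) * B $$ (i,j))"
  using assms by (simp add: trace_def index_mult_mat_sum del: index_mult_mat(1))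

abbreviation real_diag :: "nat \<Rightarrow> (nat \<Rightarrow> real) \<Rightarrow> complex mat" where
  "real_diag n \<mu> \<equiv> mat_diag n (\<lambda>i. complex_of_real (\<mu> i))"

lemma dim_mat_diag [simp]: "dim_row (mat_diag n f) = n" "dim_col (mat_diag n f) = n"
  by (simp_all add: mat_diag_def)

lemma index_mat_diag [simp]: "i < n \<Longrightarrow> j < n \<Longrightarrow> mat_diag n f $$ (i,j) = (if i = j then f j else 0)"
  by (simp add: mat_diag_def)

lemma real_diag_adjoint [simp]: "(real_diag n \<mu>)\<^sup>\<dagger> = real_diag n \<mu>"
  by (intro eq_matI) auto

lemma real_diag_sqrt_squared:
  assumes "\<And>j. j < n \<Longrightarrow> 0 \<le> \<mu> j"
  shows "real_diag n (\<lambda>j. sqrt (\<mu> j)) * real_diag n (\<lambda>j. sqrt (\<mu> j)) = real_diag n \<mu>"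
proof -
  have "complex_of_real (sqrt (\<mu> j)) * complex_of_real (sqrt (\<mu> j)) = of_real (\<mu> j)"
    if "j < n" for j
    using assms[OF that] by (simp flip: of_real_mult)
  then show ?thesis by (intro eq_matI) simp_all
qed

lemma trace_mat_diag: "trace (mat_diag n f) = (\<Sum>i<n. f i)"
  by (simp add: trace_def)

lemma det_mat_diag: "det (mat_diag n f) = (\<Prod>i<n. f i)"
proof -
  have "det (mat_diag n f) = prod_list (diag_mat (mat_diag n f))"
    by (rule det_upper_triangular) auto
  then show ?thesis by (simp add: prod_list_diag_prod atLeast0LessThan)
qed

section \<open>Orthonormal bases and the spectral theorem\<close>

definition cinner :: "nat \<Rightarrow> (nat \<Rightarrow> complex) \<Rightarrow> (nat \<Rightarrow> complex) \<Rightarrow> complex" where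
  "cinner n x y = (\<Sum>i<n. x i * cnj (y i))"

lemma cinner_add_left: "cinner n (x + y) z = cinner n x z + cinner n y z"
  by (simp add: cinner_def algebra_simps sum.distrib)

lemma cinner_scale_left: "cinner n (cscale c x) y = c * cinner n x y"
  by (simp add: cinner_def sum_distrib_left mult.assoc)

lemma cinner_zero [simp]: "cinner n 0 y = 0" "cinner n x 0 = 0"
  by (simp_all add: cinner_def)

lemma cinner_scale_right: "cinner n x (cscale c y) = cnj c * cinner n x y"
  by (simp add: cinner_def sum_distrib_left mult_ac)

lemma cnj_cinner: "cnj (cinner n x y) = cinner n y x"
  by (simp add: cinner_def mult.commute)

lemma cinner_self: "cinner n x x = of_real (\<Sum>i<n. (cmod (x i))\<^sup>2)"
  by (simp only: cinner_def complex_norm_square of_real_sum)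

lemma cinner_self_eq_0:
  assumes "x \<in> cspace n" "cinner n x x = 0" shows "x = 0"
proof
  fix i
  have "(\<Sum>i<n. (cmod (x i))\<^sup>2) = 0"
    using assms(2) unfolding cinner_self by (simp only: of_real_eq_0_iff)
  then have "\<forall>i<n. x i = 0" by (subst (asm) sum_nonneg_eq_0_iff) auto
  then show "x i = 0 i" using assms(1) by (cases "i < n") (auto simp: cspace_def)
qed

lemma cinner_mat_apply:
  assumes "A \<in> carrier_mat n m"
  shows "cinner n (mat_apply A x) y = cinner m x (mat_apply (A\<^sup>\<dagger>) y)"
proof -
  have "cinner n (mat_apply A x) y = (\<Sum>i<n. \<Sum>j<m. A $$ (i,j) * x j * cnj (y i))"
    using assms by (simp add: cinner_def mat_apply_def sum_distrib_right)
  also have "\<dots> = (\<Sum>j<m. \<Sum>i<n. A $$ (i,j) * x j * cnj (y i))" by (rule sum.swap)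
  also have "\<dots> = cinner m x (mat_apply (A\<^sup>\<dagger>) y)"
    using assms by (simp add: cinner_def mat_apply_def sum_distrib_left mult_ac)
  finally show ?thesis .
qed

definition orthonormal_family :: "nat \<Rightarrow> nat \<Rightarrow> (nat \<Rightarrow> nat \<Rightarrow> complex) \<Rightarrow> bool" where
  "orthonormal_family n m e \<longleftrightarrow> (\<forall>j<m. e j \<in> cspace n) \<and>
     (\<forall>i<m. \<forall>j<m. cinner n (e i) (e j) = (if i = j then 1 else 0))"

lemma mat_has_eigenvector:
  assumes A: "A \<in> carrier_mat n n" and "0 < n"
  obtains x \<mu> where "x \<in> cspace n" "x \<noteq> 0" "mat_apply A x = cscale \<mu> x"
proof -
  obtain as where as: "char_poly A = (\<Prod>a\<leftarrow>as. [:- a, 1:])" "length as = n"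
    using char_poly_factorized[OF A] by blast
  define \<mu> where "\<mu> = hd as"
  have "\<mu> \<in> set as" using as(2) assms(2) by (cases as) (auto simp: \<mu>_def)
  then have "eigenvalue A \<mu>"
    unfolding eigenvalue_root_char_poly[OF A] as(1)
    by (auto simp: poly_prod_list prod_list_zero_iff)
  then have "det (char_matrix A \<mu>) = 0" using eigenvalue_det[OF A] by simp
  moreover have C: "char_matrix A \<mu> \<in> carrier_mat n n" using A by simp
  ultimately obtain x where x: "x \<in> cspace n" "x \<noteq> 0" "mat_apply (char_matrix A \<mu>) x = 0"
    using det_nonzero_iff_mat_apply_injective[OF C] by blast
  have "mat_apply (char_matrix A \<mu>) x = mat_apply A x - cscale \<mu> x"
  proof
    fix i
    have "(\<Sum>j<n. (A $$ (i,j) - \<mu> * (if i = j then 1 else 0)) * x j)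
        = (\<Sum>j<n. A $$ (i,j) * x j - (if j = i then \<mu> * x i else 0))"
      by (intro sum.cong) (auto simp: left_diff_distrib)
    then have "(\<Sum>j<n. (A $$ (i,j) - \<mu> * (if i = j then 1 else 0)) * x j)
        = (\<Sum>j<n. A $$ (i,j) * x j) - \<mu> * x i"
      if "i < n" using that by (simp add: sum_subtractf)
    then show "mat_apply (char_matrix A \<mu>) x i = (mat_apply A x - cscale \<mu> x) i"
      using A x(1) by (simp add: char_matrix_def mat_apply_def cspace_def)
  qed
  then show ?thesis using that x by simp
qed

lemma subspace_basis_matrix:
  assumes W: "csubspace n W"
  obtains A where "A \<in> carrier_mat n (cvec.dim W)" "mat_range A = W"
    "\<And>x. x \<in> cspace (cvec.dim W) \<Longrightarrow> mat_apply A x = 0 \<Longrightarrow> x = 0"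
proof -
  let ?m = "cvec.dim W"
  have "csubspace ?m (cspace ?m)" by (simp add: subspace_cspace)
  then obtain f where f: "clinear f" "f ` cspace ?m = W" "inj_on f (cspace ?m)"
    by (rule subspace_isomorphism_cspace[OF _ W dim_cspace])
  obtain A where A: "A \<in> carrier_mat n ?m" "\<And>x. x \<in> cspace ?m \<Longrightarrow> mat_apply A x = f x"
    using matrix_of_linear[OF f(1), of ?m n] f(2) W by blast
  show ?thesis
  proof (rule that[OF A(1)])
    have "mat_range A = f ` cspace ?m" unfolding mat_range_def using A by (intro image_cong) auto
    then show "mat_range A = W" using f(2) by simp
    show "x = 0" if "x \<in> cspace ?m" "mat_apply A x = 0" for x
    proof (rule inj_onD[OF f(3)])
      show "f x = f 0" using that A(2) cpair.linear_0[OF f(1)] by simp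
    qed (use that(1) cvec.subspace_0[OF subspace_cspace] in auto)
  qed
qed

lemma invariant_subspace_eigenvector:
  assumes A: "A \<in> carrier_mat n n"
    and W: "csubspace n W" "mat_apply A ` W \<subseteq> W" "W \<noteq> {0}"
  obtains v \<mu> where "v \<in> W" "v \<noteq> 0" "mat_apply A v = cscale \<mu> v"
proof -
  obtain B where B: "B \<in> carrier_mat n (cvec.dim W)" "mat_range B = W"
    "\<And>x. x \<in> cspace (cvec.dim W) \<Longrightarrow> mat_apply B x = 0 \<Longrightarrow> x = 0"
    by (rule subspace_basis_matrix[OF W(1)]) blast
  have "mat_range (A * B) \<subseteq> mat_range B" using W(2) A B(1,2) mat_range_mult[of A B] by simp
  then obtain R where R: "R \<in> carrier_mat (dim_col B) (dim_col (A * B))" and AB: "A * B = B * R"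
    by (rule factor_if_mat_range_subset) (use A B(1) in simp)
  have R: "R \<in> carrier_mat (cvec.dim W) (cvec.dim W)"
    using R unfolding index_mult_mat carrier_matD(2)[OF B(1)] .
  have "cvec.dim W \<noteq> 0"
  proof
    assume "cvec.dim W = 0"
    then have "cspace (cvec.dim W) = {0}" by (auto simp: cspace_def fun_eq_iff)
    then show False using B(1,2) W(3) by (auto simp: mat_range_def)
  qed
  then obtain x \<mu> where x: "x \<in> cspace (cvec.dim W)" "x \<noteq> 0" "mat_apply R x = cscale \<mu> x"
    using mat_has_eigenvector[OF R] by blast
  show ?thesis
  proof (rule that)
    show "mat_apply B x \<in> W" using x(1) B(1,2) by (auto simp: mat_range_def)
    show "mat_apply B x \<noteq> 0" using x(1,2) B(3) by blast
    have "mat_apply A (mat_apply B x) = mat_apply B (mat_apply R x)"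
      using mat_apply_mult[of A B x] mat_apply_mult[of B R x] A B(1) R AB by simp
    also have "\<dots> = cscale \<mu> (mat_apply B x)"
      unfolding x(3) by (rule cpair.linear_scale[OF linear_mat_apply])
    finally show "mat_apply A (mat_apply B x) = cscale \<mu> (mat_apply B x)" .
  qed
qed

lemma hermitian_eigenvalue_real:
  assumes "A \<in> carrier_mat n n" "A\<^sup>\<dagger> = A" "v \<in> cspace n" "v \<noteq> 0" "mat_apply A v = cscale \<mu> v"
  shows "\<mu> \<in> \<real>"
proof -
  have "\<mu> * cinner n v v = cinner n (mat_apply A v) v" by (simp add: assms(5) cinner_scale_left)
  also have "\<dots> = cinner n v (mat_apply A v)" using cinner_mat_apply[OF assms(1)] assms(2) by simp
  also have "\<dots> = cnj \<mu> * cinner n v v" by (simp add: assms(5) cinner_scale_right)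
  finally show ?thesis using assms(3,4) cinner_self_eq_0 by (auto simp: Reals_cnj_iff)
qed

lemma normalized_multiple:
  assumes "v \<in> cspace n" "v \<noteq> 0"
  obtains c where "c \<noteq> 0" "cinner n (cscale c v) (cscale c v) = 1"
proof -
  define s where "s = (\<Sum>i<n. (cmod (v i))\<^sup>2)"
  have "cinner n v v \<noteq> 0" using assms cinner_self_eq_0 by blast
  then have "s \<noteq> 0" unfolding cinner_self s_def[symmetric] by simp
  then have "0 < s" unfolding s_def by (metis less_eq_real_def sum_nonneg zero_le_power2)
  then have "cinner n (cscale (of_real (1 / sqrt s)) v) (cscale (of_real (1 / sqrt s)) v) = 1"
    unfolding cinner_scale_left cinner_scale_right
    unfolding cinner_self s_def[symmetric]
    by (simp del: of_real_mult of_real_divide add: of_real_mult[symmetric])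
  then show ?thesis using that[of "of_real (1 / sqrt s)"] \<open>0 < s\<close> by simp
qed

lemma hermitian_invariant_subspace_unit_eigenvector:
  assumes A: "A \<in> carrier_mat n n" "A\<^sup>\<dagger> = A"
    and W: "csubspace n W" "mat_apply A ` W \<subseteq> W" "W \<noteq> {0}"
  obtains v \<mu> where "v \<in> W" "cinner n v v = 1" "mat_apply A v = cscale (complex_of_real \<mu>) v"
proof -
  obtain w \<nu> where w: "w \<in> W" "w \<noteq> 0" "mat_apply A w = cscale \<nu> w"
    by (rule invariant_subspace_eigenvector[OF A(1) W])
  have w_cspace: "w \<in> cspace n" using w(1) W(1) by blast
  obtain c where c: "cinner n (cscale c w) (cscale c w) = 1"
    using normalized_multiple[OF w_cspace w(2)] by blast
  have "cscale c w \<in> W" using w(1) W(1) cvec.subspace_scale by blast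
  moreover have "mat_apply A (cscale c w) = cscale \<nu> (cscale c w)"
    unfolding cpair.linear_scale[OF linear_mat_apply] w(3) by (simp add: mult.commute)
  moreover have "\<nu> = of_real (Re \<nu>)" using hermitian_eigenvalue_real[OF A w_cspace w(2,3)] by simp
  ultimately show ?thesis using that c by metis
qed

lemma span_insert_orthogonal_complement:
  assumes W: "cvec.subspace W" and v: "v \<in> W" "cinner n v v = 1"
  shows "cvec.span (insert v {x \<in> W. cinner n x v = 0}) = W"
proof (rule cvec.span_subspace[OF _ _ W])
  let ?W = "{x \<in> W. cinner n x v = 0}"
  show "insert v ?W \<subseteq> W" using v(1) by blast
  show "W \<subseteq> cvec.span (insert v ?W)"
  proof
    fix x assume "x \<in> W"
    define y where "y = x - cscale (cinner n x v) v"
    have "y \<in> W" using \<open>x \<in> W\<close> v(1) W by (simp add: y_def cvec.subspace_diff cvec.subspace_scale)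
    moreover have "cinner n y v + cinner n x v = cinner n x v"
      using cinner_add_left[of n y "cscale (cinner n x v) v" v] v(2)
      by (simp add: y_def cinner_scale_left)
    ultimately have "y \<in> cvec.span ?W" by (simp add: cvec.span_base)
    then show "x \<in> cvec.span (insert v ?W)" unfolding cvec.span_insert y_def by blast
  qed
qed

lemma orthogonal_complement_in_subspace:
  assumes W: "csubspace n W" and v: "v \<in> W" "cinner n v v = 1"
  shows "csubspace n {x \<in> W. cinner n x v = 0}" "cvec.dim {x \<in> W. cinner n x v = 0} < cvec.dim W"
proof -
  let ?W = "{x \<in> W. cinner n x v = 0}"
  show sub: "csubspace n ?W"
    using W unfolding cvec.subspace_def by (auto simp: cinner_add_left cinner_scale_left)
  have "v \<notin> ?W" using v(2) by simp
  then have "?W \<noteq> W" using v(1) by blast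
  then show "cvec.dim ?W < cvec.dim W"
    using subspace_eq_if_dim_le[OF conjunct1[OF sub] _ conjunct2[OF W]]
    by (force simp: not_le[symmetric])
qed

lemma orthonormal_family_extend:
  assumes "orthonormal_family n m e" "v \<in> cspace n" "cinner n v v = 1"
    "\<And>j. j < m \<Longrightarrow> cinner n (e j) v = 0"
  shows "orthonormal_family n (Suc m) (e(m := v))"
proof -
  have "cinner n v (e j) = 0" if "j < m" for j
    using assms(4)[OF that] cnj_cinner[of n "e j" v] by simp
  then show ?thesis using assms by (auto simp: orthonormal_family_def less_Suc_eq)
qed

text \<open>For \<open>A = 1\<close> this is Gram-Schmidt orthonormalisation, for \<open>W = cspace n\<close> the spectral theorem.\<close>

lemma hermitian_invariant_subspace_eigenbasis:
  assumes A: "A \<in> carrier_mat n n" "A\<^sup>\<dagger> = A"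
    and "csubspace n W" "mat_apply A ` W \<subseteq> W"
  shows "\<exists>m e \<mu>. orthonormal_family n m e \<and> cvec.span (e ` {..<m}) = W \<and>
    (\<forall>j<m. mat_apply A (e j) = cscale (of_real (\<mu> j :: real)) (e j))"
  using assms(3-)
proof (induction "cvec.dim W" arbitrary: W rule: less_induct)
  case less
  show ?case
  proof (cases "W = {0}")
    case True
    then show ?thesis by (intro exI[of _ 0]) (simp add: orthonormal_family_def)
  next
    case False
    obtain v \<nu> where v: "v \<in> W" "cinner n v v = 1"
      and Av: "mat_apply A v = cscale (complex_of_real \<nu>) v"
      by (rule hermitian_invariant_subspace_unit_eigenvector[OF A less.prems False])
    define W' where "W' = {x \<in> W. cinner n x v = 0}"
    have "csubspace n W'" "cvec.dim W' < cvec.dim W"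
      unfolding W'_def using orthogonal_complement_in_subspace[OF _ v] less.prems(1) by blast+
    moreover have "mat_apply A ` W' \<subseteq> W'"
      using less.prems(2)
      by (auto simp: W'_def cinner_mat_apply[OF A(1)] A(2) Av cinner_scale_right)
    ultimately obtain m e \<mu> where e: "orthonormal_family n m e" "cvec.span (e ` {..<m}) = W'"
      "\<forall>j<m. mat_apply A (e j) = cscale (of_real (\<mu> j :: real)) (e j)"
      using less.hyps[of W'] by blast
    have "e j \<in> W'" if "j < m" for j using that e(2) cvec.span_base[of "e j" "e ` {..<m}"] by auto
    then have "orthonormal_family n (Suc m) (e(m := v))"
      using v less.prems(1) by (intro orthonormal_family_extend e(1)) (auto simp: W'_def)
    moreover have "cvec.span ((e(m := v)) ` {..<Suc m}) = W"
    proof -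
      have "(e(m := v)) ` {..<Suc m} = insert v (e ` {..<m})" by (auto simp: lessThan_Suc)
      then have "cvec.span ((e(m := v)) ` {..<Suc m}) = cvec.span (insert v W')"
        by (simp add: cvec.span_insert e(2)[symmetric] cvec.span_span)
      then show ?thesis
        using span_insert_orthogonal_complement[OF _ v] less.prems(1) by (simp add: W'_def)
    qed
    moreover have "\<forall>j<Suc m. mat_apply A ((e(m := v)) j)
        = cscale (of_real ((\<mu>(m := \<nu>)) j)) ((e(m := v)) j)"
      using e(3) Av by (simp add: less_Suc_eq)
    ultimately show ?thesis by blast
  qed
qed

lemma isometry_injective:
  assumes "Q \<in> carrier_mat n m" "Q\<^sup>\<dagger> * Q = 1\<^sub>m m" "x \<in> cspace m" "mat_apply Q x = 0"
  shows "x = 0"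
proof -
  have "x = mat_apply (Q\<^sup>\<dagger> * Q) x" using assms(2,3) by (simp add: mat_apply_one)
  also have "\<dots> = 0" using mat_apply_mult[of "Q\<^sup>\<dagger>" Q x] assms(4) by simp
  finally show ?thesis .
qed

lemma orthonormal_family_matrix:
  assumes "orthonormal_family n m e"
  obtains Q where "Q \<in> carrier_mat n m" "Q\<^sup>\<dagger> * Q = 1\<^sub>m m" "mat_range Q = cvec.span (e ` {..<m})"
    "\<And>j. j < m \<Longrightarrow> mat_apply Q (unit_fun j) = e j"
proof
  define Q where "Q = mat n m (\<lambda>(a,j). e j a)"
  show "Q \<in> carrier_mat n m" by (simp add: Q_def)
  show "Q\<^sup>\<dagger> * Q = 1\<^sub>m m"
  proof (rule eq_matI)
    fix i j assume "i < dim_row (1\<^sub>m m :: complex mat)" "j < dim_col (1\<^sub>m m :: complex mat)"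
    then have ij: "i < m" "j < m" by simp_all
    then have "(Q\<^sup>\<dagger> * Q) $$ (i,j) = cinner n (e j) (e i)"
      by (subst index_mult_mat_sum) (simp_all add: Q_def cinner_def mult.commute)
    then show "(Q\<^sup>\<dagger> * Q) $$ (i,j) = 1\<^sub>m m $$ (i,j)"
      using assms ij by (simp add: orthonormal_family_def)
  qed (simp_all add: Q_def)
  show col: "mat_apply Q (unit_fun j) = e j" if "j < m" for j
    using that assms
    by (auto simp: mat_apply_unit_fun Q_def orthonormal_family_def cspace_def fun_eq_iff)
  have "mat_range Q = cvec.span (mat_apply Q ` unit_fun ` {..<m})"
    by (simp add: mat_range_def cspace_eq_span_unit_fun cpair.linear_span_image[OF linear_mat_apply] Q_def)
  also have "mat_apply Q ` unit_fun ` {..<m} = e ` {..<m}" using col by (simp add: image_image)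
  finally show "mat_range Q = cvec.span (e ` {..<m})" .
qed

lemma decreasing_rearrangement:
  fixes \<mu> :: "nat \<Rightarrow> real"
  obtains p where "bij_betw p {..<n} {..<n}" "\<And>i j. i \<le> j \<Longrightarrow> j < n \<Longrightarrow> \<mu> (p j) \<le> \<mu> (p i)"
proof
  define xs where "xs = sort_key (\<lambda>i. - \<mu> i) [0..<n]"
  show "bij_betw ((!) xs) {..<n} {..<n}" by (rule bij_betw_nth) (auto simp: xs_def)
  show "\<mu> (xs ! j) \<le> \<mu> (xs ! i)" if "i \<le> j" "j < n" for i j
    using sorted_nth_mono[of "map (\<lambda>i. - \<mu> i) xs" i j] that by (simp add: xs_def)
qed

lemma orthonormal_family_rearrange:
  assumes "orthonormal_family n m e" "bij_betw p {..<m} {..<m}"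
  shows "orthonormal_family n m (e \<circ> p)"
proof -
  have "p j < m" if "j < m" for j using assms(2) that by (auto simp: bij_betw_def)
  moreover have "p i = p j \<longleftrightarrow> i = j" if "i < m" "j < m" for i j
    using assms(2) that by (auto simp: bij_betw_def inj_on_def)
  ultimately show ?thesis using assms(1) by (simp add: orthonormal_family_def)
qed

lemma hermitian_invariant_subspace_diagonalization:
  assumes A: "A \<in> carrier_mat n n" "A\<^sup>\<dagger> = A"
    and W: "csubspace n W" "mat_apply A ` W \<subseteq> W"
  obtains Q \<mu> where "Q \<in> carrier_mat n (cvec.dim W)" "Q\<^sup>\<dagger> * Q = 1\<^sub>m (cvec.dim W)" "mat_range Q = W"
    "A * Q = Q * real_diag (cvec.dim W) \<mu>" "\<And>i j. i \<le> j \<Longrightarrow> j < cvec.dim W \<Longrightarrow> \<mu> j \<le> \<mu> i"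
proof -
  obtain m e \<mu> where e: "orthonormal_family n m e" "cvec.span (e ` {..<m}) = W"
    "\<forall>j<m. mat_apply A (e j) = cscale (of_real (\<mu> j :: real)) (e j)"
    using hermitian_invariant_subspace_eigenbasis[OF A W] by blast
  obtain p where p: "bij_betw p {..<m} {..<m}" "\<And>i j. i \<le> j \<Longrightarrow> j < m \<Longrightarrow> \<mu> (p j) \<le> \<mu> (p i)"
    by (rule decreasing_rearrangement[of m \<mu>]) blast
  obtain Q where Q: "Q \<in> carrier_mat n m" "Q\<^sup>\<dagger> * Q = 1\<^sub>m m"
    "mat_range Q = cvec.span ((e \<circ> p) ` {..<m})" "\<And>j. j < m \<Longrightarrow> mat_apply Q (unit_fun j) = (e \<circ> p) j"
    by (rule orthonormal_family_matrix[OF orthonormal_family_rearrange[OF e(1) p(1)]]) blast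
  have range: "mat_range Q = W"
    using Q(3) e(2) bij_betw_imp_surj_on[OF p(1)] image_comp[of e p "{..<m}"] by simp
  have dim: "cvec.dim W = m"
    using dim_linear_image_eq[of "cspace m" "mat_apply Q"] isometry_injective[OF Q(1,2)] range Q(1)
    by (simp add: mat_range_def dim_cspace subspace_cspace linear_mat_apply)
  have "A * Q = Q * real_diag m (\<mu> \<circ> p)"
  proof (rule eq_matI)
    fix i j assume "i < dim_row (Q * real_diag m (\<mu> \<circ> p))" "j < dim_col (Q * real_diag m (\<mu> \<circ> p))"
    then have ij: "i < n" "j < m" using Q(1) by simp_all
    then have "p j < m" using p(1) by (auto simp: bij_betw_def)
    have "(A * Q) $$ (i,j) = mat_apply (A * Q) (unit_fun j) i"
      using ij A(1) Q(1) by (simp add: mat_apply_unit_fun)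
    also have "\<dots> = mat_apply A ((e \<circ> p) j) i" using A(1) Q(1,4) ij by (simp add: mat_apply_mult)
    also have "\<dots> = of_real (\<mu> (p j)) * mat_apply Q (unit_fun j) i"
      using e(3) \<open>p j < m\<close> Q(4) ij by simp
    also have "\<dots> = Q $$ (i,j) * of_real (\<mu> (p j))" using ij Q(1) by (simp add: mat_apply_unit_fun)
    also have "\<dots> = (Q * real_diag m (\<mu> \<circ> p)) $$ (i,j)"
      using ij by (simp add: mat_diag_mult_right[OF Q(1)])
    finally show "(A * Q) $$ (i,j) = (Q * real_diag m (\<mu> \<circ> p)) $$ (i,j)" .
  qed (use A(1) Q(1) in simp_all)
  then show ?thesis using that[of Q "\<mu> \<circ> p"] Q(1,2) range p(2) unfolding dim by simp
qed

definition unitary_mat :: "nat \<Rightarrow> complex mat \<Rightarrow> bool" where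
  "unitary_mat n U \<longleftrightarrow> U \<in> carrier_mat n n \<and> U\<^sup>\<dagger> * U = 1\<^sub>m n \<and> U * U\<^sup>\<dagger> = 1\<^sub>m n"

lemma unitary_matD:
  assumes "unitary_mat n U"
  shows "U \<in> carrier_mat n n" "U\<^sup>\<dagger> * U = 1\<^sub>m n" "U * U\<^sup>\<dagger> = 1\<^sub>m n"
  using assms by (simp_all add: unitary_mat_def)

theorem spectral_theorem:
  assumes A: "A \<in> carrier_mat n n" "A\<^sup>\<dagger> = A"
  obtains U \<mu> where "unitary_mat n U" "A = U * real_diag n \<mu> * U\<^sup>\<dagger>" "\<And>i j. i \<le> j \<Longrightarrow> j < n \<Longrightarrow> \<mu> j \<le> \<mu> i"
proof -
  have "csubspace n (cspace n)" "mat_apply A ` cspace n \<subseteq> cspace n"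
    using mat_apply_in_cspace[OF A(1)] subspace_cspace by auto
  then obtain U \<mu> where U: "U \<in> carrier_mat n n" "U\<^sup>\<dagger> * U = 1\<^sub>m n" "A * U = U * real_diag n \<mu>"
    and \<mu>: "\<And>i j. i \<le> j \<Longrightarrow> j < n \<Longrightarrow> \<mu> j \<le> \<mu> i"
    by (rule hermitian_invariant_subspace_diagonalization[OF A, of "cspace n", unfolded dim_cspace])
      blast
  have "U * U\<^sup>\<dagger> = 1\<^sub>m n" using mat_mult_left_right_inverse[OF _ U(1,2)] U(1) by simp
  moreover from this have "A = U * real_diag n \<mu> * U\<^sup>\<dagger>"
    unfolding U(3)[symmetric] using A(1) U(1) by (simp add: mult_mat_assoc)
  ultimately show ?thesis using that U(1,2) \<mu> unfolding unitary_mat_def by blast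
qed

lemma unitary_mat_adjoint: "unitary_mat n U \<Longrightarrow> unitary_mat n (U\<^sup>\<dagger>)"
  by (simp add: unitary_mat_def)

lemma norm_det_unitary:
  assumes "unitary_mat n U" shows "cmod (det U) = 1"
proof -
  note U = unitary_matD(1,2)[OF assms]
  have "of_real ((cmod (det U))\<^sup>2) = det (U\<^sup>\<dagger> * U)"
    unfolding complex_norm_square
    using U(1) by (simp add: det_mult[of _ n] det_mat_adjoint mult.commute)
  then have "(cmod (det U))\<^sup>2 = 1" unfolding U(2) det_one by (simp only: of_real_eq_1_iff)
  then show ?thesis using norm_ge_zero[of "det U"] by (auto simp: power2_eq_1_iff)
qed

lemma unitary_column_norm:
  assumes "unitary_mat n U" "j < n" shows "(\<Sum>a<n. (cmod (U $$ (a,j)))\<^sup>2) = 1"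
proof -
  note U = unitary_matD(1,2)[OF assms(1)]
  have "of_real (\<Sum>a<n. (cmod (U $$ (a,j)))\<^sup>2) = (U\<^sup>\<dagger> * U) $$ (j,j)"
    using U(1) assms(2) unfolding of_real_sum complex_norm_square
    by (subst index_mult_mat_sum) (simp_all add: mult.commute)
  then show ?thesis unfolding U(2) using assms(2) by (simp del: of_real_sum of_real_power)
qed

lemma norm_index_unitary_le_1:
  assumes "unitary_mat n U" "i < n" "j < n" shows "cmod (U $$ (i,j)) \<le> 1"
proof -
  have "(cmod (U $$ (i,j)))\<^sup>2 \<le> (\<Sum>a<n. (cmod (U $$ (a,j)))\<^sup>2)"
    using assms(2) by (intro member_le_sum) auto
  then show ?thesis using unitary_column_norm[OF assms(1,3)] by (simp add: abs_square_le_1)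
qed

lemma trace_unitary_conj:
  assumes "unitary_mat n U" "D \<in> carrier_mat n n"
  shows "trace (U * D * U\<^sup>\<dagger>) = trace D"
proof -
  note U = unitary_matD(1,2)[OF assms(1)]
  have "trace (U * D * U\<^sup>\<dagger>) = trace (U\<^sup>\<dagger> * (U * D))"
    by (rule trace_mult_commute) (use U assms in simp_all)
  also have "U\<^sup>\<dagger> * (U * D) = D" using U assms(2) by (simp add: mult_mat_assoc[symmetric])
  finally show ?thesis .
qed

lemma mult_unitary_conj:
  assumes "unitary_mat n U" "D \<in> carrier_mat n n" "E \<in> carrier_mat n n"
  shows "U * D * U\<^sup>\<dagger> * (U * E * U\<^sup>\<dagger>) = U * (D * E) * U\<^sup>\<dagger>"
proof -
  note U = unitary_matD(1,2)[OF assms(1)]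
  have "U * D * U\<^sup>\<dagger> * (U * E * U\<^sup>\<dagger>) = U * D * (U\<^sup>\<dagger> * U) * E * U\<^sup>\<dagger>"
    using U(1) assms(2,3) by (simp add: mult_mat_assoc)
  then show ?thesis unfolding U(2) using U(1) assms(2,3) by (simp add: mult_mat_assoc)
qed

lemma det_unitary_conj:
  assumes "unitary_mat n U" "D \<in> carrier_mat n n"
  shows "det (U * D * U\<^sup>\<dagger>) = det D"
proof -
  note U = unitary_matD(1,3)[OF assms(1)]
  have "det U * det (U\<^sup>\<dagger>) = 1" using U det_mult[of U n "U\<^sup>\<dagger>"] by simp
  then show ?thesis
    using U(1) assms(2) by (simp add: det_mult[of _ n] mult.commute mult.left_commute)
qed

lemma gram_eigenvalue:
  assumes A: "A \<in> carrier_mat m n" and U: "unitary_mat n U"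
    and gram: "A\<^sup>\<dagger> * A = U * real_diag n \<mu> * U\<^sup>\<dagger>"
    and j: "j < n"
  shows "\<mu> j = (\<Sum>i<m. (cmod ((A * U) $$ (i,j)))\<^sup>2)"
proof -
  note U' = unitary_matD(1,2)[OF U]
  have "(A * U)\<^sup>\<dagger> * (A * U) = U\<^sup>\<dagger> * (A\<^sup>\<dagger> * A) * U"
    using A U' by (simp add: mat_adjoint_mult mult_mat_assoc)
  also have "\<dots> = (U\<^sup>\<dagger> * U) * real_diag n \<mu> * (U\<^sup>\<dagger> * U)"
    unfolding gram using U'(1) by (simp add: mult_mat_assoc)
  also have "\<dots> = real_diag n \<mu>" unfolding U'(2) by simp
  finally have "of_real (\<mu> j) = ((A * U)\<^sup>\<dagger> * (A * U)) $$ (j,j)" using j by simp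
  also have "\<dots> = of_real (\<Sum>i<m. (cmod ((A * U) $$ (i,j)))\<^sup>2)"
    unfolding of_real_sum complex_norm_square using A U' j
    by (subst index_mult_mat_sum) (simp_all add: mult.commute del: index_mult_mat(1))
  finally show ?thesis by (simp only: of_real_eq_iff)
qed

section \<open>Orthogonal projections\<close>

definition onb :: "nat \<Rightarrow> (nat \<Rightarrow> complex) set \<Rightarrow> complex mat" where
  "onb n W = (SOME Q. Q \<in> carrier_mat n (cvec.dim W) \<and> Q\<^sup>\<dagger> * Q = 1\<^sub>m (cvec.dim W) \<and> mat_range Q = W)"

definition proj :: "nat \<Rightarrow> (nat \<Rightarrow> complex) set \<Rightarrow> complex mat" where
  "proj n W = onb n W * (onb n W)\<^sup>\<dagger>"

lemma
  assumes "csubspace n W"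
  shows onb_carrier: "onb n W \<in> carrier_mat n (cvec.dim W)"
    and onb_isometry: "(onb n W)\<^sup>\<dagger> * onb n W = 1\<^sub>m (cvec.dim W)"
    and mat_range_onb: "mat_range (onb n W) = W"
proof -
  have "mat_apply (1\<^sub>m n) x = x" if "x \<in> W" for x using assms that by (intro mat_apply_one) blast
  then have "mat_apply (1\<^sub>m n) ` W \<subseteq> W" by auto
  then obtain Q where "Q \<in> carrier_mat n (cvec.dim W)" "Q\<^sup>\<dagger> * Q = 1\<^sub>m (cvec.dim W)" "mat_range Q = W"
    by (rule hermitian_invariant_subspace_diagonalization[OF one_carrier_mat mat_adjoint_one assms])
  then have "\<exists>Q. Q \<in> carrier_mat n (cvec.dim W) \<and> Q\<^sup>\<dagger> * Q = 1\<^sub>m (cvec.dim W) \<and> mat_range Q = W"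
    by blast
  from someI_ex[OF this, folded onb_def]
  show "onb n W \<in> carrier_mat n (cvec.dim W)" "(onb n W)\<^sup>\<dagger> * onb n W = 1\<^sub>m (cvec.dim W)"
    "mat_range (onb n W) = W"
    by simp_all
qed

lemma proj_carrier: "csubspace n W \<Longrightarrow> proj n W \<in> carrier_mat n n"
  using onb_carrier[of W n] by (simp add: proj_def)

lemma proj_adjoint: "(proj n W)\<^sup>\<dagger> = proj n W"
  by (simp add: proj_def mat_adjoint_mult)

lemma trace_proj:
  assumes "csubspace n W" shows "trace (proj n W) = of_nat (cvec.dim W)"
  unfolding proj_def
  using trace_mult_commute[of "onb n W" "(onb n W)\<^sup>\<dagger>"] onb_isometry[OF assms] by simp

lemma proj_mult_if_mat_range_subset:
  assumes W: "csubspace n W" and A: "A \<in> carrier_mat n m" "mat_range A \<subseteq> W"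
  shows "proj n W * A = A"
proof -
  note Q = onb_carrier[OF W] onb_isometry[OF W]
  have "mat_range A \<subseteq> mat_range (onb n W)" "dim_row A = dim_row (onb n W)"
    using A Q(1) mat_range_onb[OF W] by simp_all
  then obtain R where R: "R \<in> carrier_mat (dim_col (onb n W)) (dim_col A)" and AR: "A = onb n W * R"
    by (rule factor_if_mat_range_subset)
  have "proj n W * A = onb n W * ((onb n W)\<^sup>\<dagger> * onb n W) * R"
    using R unfolding AR proj_def by (simp add: mult_mat_assoc)
  also have "\<dots> = onb n W * R" unfolding Q(2) using Q(1) by simp
  also have "\<dots> = A" by (rule AR[symmetric])
  finally show ?thesis .
qed

lemma mat_range_proj_subset: "csubspace n W \<Longrightarrow> mat_range (proj n W) \<subseteq> W"
  using mat_range_onb[of W n]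
    mat_apply_in_cspace[of "(onb n W)\<^sup>\<dagger>" "dim_col (onb n W)" "dim_row (onb n W)"]
  by (auto simp: proj_def mat_range_def mat_apply_mult)

lemma proj_mult_proj_if_subset:
  assumes "csubspace n V" "csubspace n W" "V \<subseteq> W"
  shows "proj n W * proj n V = proj n V"
  using assms mat_range_proj_subset
  by (intro proj_mult_if_mat_range_subset[of _ _ _ n]) (auto intro: proj_carrier)

lemma mat_apply_proj:
  assumes "csubspace n W" "w \<in> W" shows "mat_apply (proj n W) w = w"
proof -
  obtain x where x: "w = mat_apply (onb n W) x"
    using mat_range_onb[OF assms(1)] assms(2) by (auto simp: mat_range_def)
  have "proj n W * onb n W = onb n W"
    by (rule proj_mult_if_mat_range_subset[OF assms(1) onb_carrier[OF assms(1)]])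
      (simp add: mat_range_onb[OF assms(1)])
  then show ?thesis
    unfolding x using mat_apply_mult[of "proj n W" "onb n W" x] by (simp add: proj_def)
qed

lemma trace_adjoint_mult_self:
  "trace (A\<^sup>\<dagger> * A) = of_real (\<Sum>p\<in>{..<dim_col A} \<times> {..<dim_row A}. (cmod (A $$ (snd p, fst p)))\<^sup>2)"
  unfolding of_real_sum complex_norm_square
  by (simp add: trace_adjoint_mult sum.cartesian_product case_prod_unfold mult.commute)

lemma trace_Cauchy_Schwarz:
  assumes "dim_row A = dim_row B" "dim_col A = dim_col B"
  shows "(Re (trace (A\<^sup>\<dagger> * B)))\<^sup>2 \<le> Re (trace (A\<^sup>\<dagger> * A)) * Re (trace (B\<^sup>\<dagger> * B))"
proof -
  let ?P = "{..<dim_col A} \<times> {..<dim_row A}"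
  define a b where "a p = cmod (A $$ (snd p, fst p))" and "b p = cmod (B $$ (snd p, fst p))" for p
  have "\<bar>Re (trace (A\<^sup>\<dagger> * B))\<bar> \<le> cmod (\<Sum>p\<in>?P. cnj (A $$ (snd p, fst p)) * B $$ (snd p, fst p))"
    using assms abs_Re_le_cmod
    by (simp add: trace_adjoint_mult sum.cartesian_product case_prod_unfold del: Re_sum times_complex.simps)
  also have "\<dots> \<le> (\<Sum>p\<in>?P. \<bar>a p\<bar> * \<bar>b p\<bar>)" by (rule sum_norm_le) (simp add: norm_mult a_def b_def)
  also have "\<dots> \<le> L2_set a ?P * L2_set b ?P" by (rule L2_set_mult_ineq)
  finally have "(Re (trace (A\<^sup>\<dagger> * B)))\<^sup>2 \<le> (L2_set a ?P * L2_set b ?P)\<^sup>2"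
    by (rule abs_le_square_iff[THEN iffD1, OF order_trans]) simp
  also have "\<dots> = (\<Sum>p\<in>?P. (a p)\<^sup>2) * (\<Sum>p\<in>?P. (b p)\<^sup>2)"
    by (simp add: power_mult_distrib L2_set_def sum_nonneg)
  also have "\<dots> = Re (trace (A\<^sup>\<dagger> * A)) * Re (trace (B\<^sup>\<dagger> * B))"
    using assms by (simp add: trace_adjoint_mult_self a_def b_def del: of_real_sum of_real_power)
  finally show ?thesis .
qed

definition overlap :: "nat \<Rightarrow> (nat \<Rightarrow> complex) set \<Rightarrow> (nat \<Rightarrow> complex) set \<Rightarrow> real" where
  "overlap n V W = Re (trace (proj n V * proj n W))"

lemma overlap_nonneg:
  assumes "csubspace n V" "csubspace n W" shows "0 \<le> overlap n V W"
proof -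
  let ?Q = "onb n V" and ?R = "onb n W"
  note c = onb_carrier[OF assms(1)] onb_carrier[OF assms(2)]
  have "trace (proj n V * proj n W) = trace (?Q * (?Q\<^sup>\<dagger> * ?R * ?R\<^sup>\<dagger>))"
    using c by (simp add: proj_def mult_mat_assoc)
  also have "\<dots> = trace (?Q\<^sup>\<dagger> * ?R * ?R\<^sup>\<dagger> * ?Q)" by (rule trace_mult_commute) (use c in simp_all)
  also have "?Q\<^sup>\<dagger> * ?R * ?R\<^sup>\<dagger> * ?Q = (?R\<^sup>\<dagger> * ?Q)\<^sup>\<dagger> * (?R\<^sup>\<dagger> * ?Q)"
    using c by (simp add: mat_adjoint_mult mult_mat_assoc)
  finally show ?thesis
    unfolding overlap_def trace_adjoint_mult_self by (simp add: sum_nonneg del: of_real_sum)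
qed

lemma overlap_self: "csubspace n W \<Longrightarrow> overlap n W W = real (cvec.dim W)"
  by (simp add: overlap_def proj_mult_proj_if_subset trace_proj)

definition frame_op :: "nat \<Rightarrow> ('i \<Rightarrow> (nat \<Rightarrow> complex) set) \<Rightarrow> 'i set \<Rightarrow> complex mat" where
  "frame_op n W I = mat n n (\<lambda>p. \<Sum>i\<in>I. proj n (W i) $$ p)"

lemma frame_op_carrier [simp]: "frame_op n W I \<in> carrier_mat n n"
  by (simp add: frame_op_def)

lemma dim_frame_op [simp]: "dim_row (frame_op n W I) = n" "dim_col (frame_op n W I) = n"
  by (simp_all add: frame_op_def)

context
  fixes n :: nat and I :: "'i set" and W :: "'i \<Rightarrow> (nat \<Rightarrow> complex) set"
  assumes W: "\<And>i. i \<in> I \<Longrightarrow> csubspace n (W i)"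
begin

lemma frame_op_adjoint: "(frame_op n W I)\<^sup>\<dagger> = frame_op n W I"
proof (rule eq_matI)
  fix a b assume "a < dim_row (frame_op n W I)" "b < dim_col (frame_op n W I)"
  then have ab: "a < n" "b < n" by (simp_all add: frame_op_def)
  have "cnj (proj n (W i) $$ (b,a)) = proj n (W i) $$ (a,b)" if "i \<in> I" for i
    using index_mat_adjoint[of a "proj n (W i)" b] proj_adjoint[of n "W i"]
      proj_carrier[OF W[OF that]] ab by simp
  then show "(frame_op n W I)\<^sup>\<dagger> $$ (a,b) = frame_op n W I $$ (a,b)"
    using ab by (simp add: frame_op_def)
qed (simp_all add: frame_op_def)

lemma trace_mult_frame_op:
  assumes "A \<in> carrier_mat n n"
  shows "trace (A * frame_op n W I) = (\<Sum>i\<in>I. trace (A * proj n (W i)))"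
proof -
  have "trace (A * frame_op n W I) = (\<Sum>a<n. \<Sum>b<n. \<Sum>i\<in>I. A $$ (a,b) * proj n (W i) $$ (b,a))"
    using assms
    by (simp add: trace_def index_mult_mat_sum frame_op_def sum_distrib_left del: index_mult_mat(1))
  also have "\<dots> = (\<Sum>a<n. \<Sum>i\<in>I. \<Sum>b<n. A $$ (a,b) * proj n (W i) $$ (b,a))"
    by (intro sum.cong[OF refl] sum.swap)
  also have "\<dots> = (\<Sum>i\<in>I. \<Sum>a<n. \<Sum>b<n. A $$ (a,b) * proj n (W i) $$ (b,a))" by (rule sum.swap)
  also have "\<dots> = (\<Sum>i\<in>I. trace (A * proj n (W i)))"
  proof (rule sum.cong[OF refl])
    fix i assume "i \<in> I"
    then have "proj n (W i) \<in> carrier_mat n n" by (intro proj_carrier W)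
    then show "(\<Sum>a<n. \<Sum>b<n. A $$ (a,b) * proj n (W i) $$ (b,a)) = trace (A * proj n (W i))"
      using assms by (simp add: trace_def index_mult_mat_sum del: index_mult_mat(1))
  qed
  finally show ?thesis .
qed

lemma trace_frame_op: "trace (frame_op n W I) = of_nat (\<Sum>i\<in>I. cvec.dim (W i))"
proof -
  have "trace (frame_op n W I) = trace (1\<^sub>m n * frame_op n W I)"
    using left_mult_one_mat[OF frame_op_carrier] by simp
  also have "\<dots> = (\<Sum>i\<in>I. trace (1\<^sub>m n * proj n (W i)))" by (rule trace_mult_frame_op) simp
  also have "\<dots> = (\<Sum>i\<in>I. of_nat (cvec.dim (W i)))"
    by (intro sum.cong refl) (simp add: left_mult_one_mat[OF proj_carrier[OF W]] trace_proj[OF W])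
  finally show ?thesis by simp
qed

lemma trace_frame_op_squared:
  "Re (trace (frame_op n W I * frame_op n W I)) = (\<Sum>i\<in>I. \<Sum>j\<in>I. overlap n (W i) (W j))"
proof -
  have "trace (frame_op n W I * frame_op n W I) = (\<Sum>j\<in>I. trace (proj n (W j) * frame_op n W I))"
  proof (subst trace_mult_frame_op[OF frame_op_carrier], rule sum.cong[OF refl])
    fix j assume "j \<in> I"
    then have "proj n (W j) \<in> carrier_mat n n" by (intro proj_carrier W)
    then show "trace (frame_op n W I * proj n (W j)) = trace (proj n (W j) * frame_op n W I)"
      by (intro trace_mult_commute) simp_all
  qed
  also have "\<dots> = (\<Sum>j\<in>I. \<Sum>i\<in>I. trace (proj n (W j) * proj n (W i)))"
    by (intro sum.cong refl trace_mult_frame_op proj_carrier W)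
  finally show ?thesis by (simp add: overlap_def)
qed

text \<open>Cauchy-Schwarz for the trace, against the projection onto \<open>Z\<close>, which fixes the frame operator.\<close>

lemma sum_dim_squared_le_overlaps:
  assumes Z: "csubspace n Z" and sub: "\<And>i. i \<in> I \<Longrightarrow> W i \<subseteq> Z"
  shows "(\<Sum>i\<in>I. real (cvec.dim (W i)))\<^sup>2 \<le> real (cvec.dim Z) * (\<Sum>i\<in>I. \<Sum>j\<in>I. overlap n (W i) (W j))"
proof -
  have "trace (proj n Z * frame_op n W I) = (\<Sum>i\<in>I. trace (proj n (W i)))"
    using proj_mult_proj_if_subset[OF W Z sub] by (simp add: trace_mult_frame_op proj_carrier[OF Z])
  then have "Re (trace ((proj n Z)\<^sup>\<dagger> * frame_op n W I)) = (\<Sum>i\<in>I. real (cvec.dim (W i)))"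
    by (simp add: proj_adjoint trace_proj[OF W])
  moreover have "(proj n Z)\<^sup>\<dagger> * proj n Z = proj n Z"
    by (simp add: proj_adjoint proj_mult_proj_if_subset[OF Z Z])
  ultimately show ?thesis
    using trace_Cauchy_Schwarz[of "proj n Z" "frame_op n W I"] proj_carrier[OF Z]
      frame_op_carrier[of n W I]
    by (simp add: trace_proj[OF Z] frame_op_adjoint trace_frame_op_squared)
qed

end

section \<open>Gram determinants\<close>

lemma gram_spectral:
  assumes A: "A \<in> carrier_mat m n"
  obtains U \<mu> where "unitary_mat n U" "A\<^sup>\<dagger> * A = U * real_diag n \<mu> * U\<^sup>\<dagger>"
    "\<And>i j. i \<le> j \<Longrightarrow> j < n \<Longrightarrow> \<mu> j \<le> \<mu> i" "\<And>j. j < n \<Longrightarrow> 0 \<le> \<mu> j"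
    "Re (det (A\<^sup>\<dagger> * A)) = (\<Prod>j<n. \<mu> j)" "Re (trace (A\<^sup>\<dagger> * A)) = (\<Sum>j<n. \<mu> j)"
proof -
  have G: "A\<^sup>\<dagger> * A \<in> carrier_mat n n" "(A\<^sup>\<dagger> * A)\<^sup>\<dagger> = A\<^sup>\<dagger> * A"
    using A by (simp_all add: mat_adjoint_mult)
  obtain U \<mu> where U: "unitary_mat n U" "A\<^sup>\<dagger> * A = U * real_diag n \<mu> * U\<^sup>\<dagger>"
    and dec: "\<And>i j. i \<le> j \<Longrightarrow> j < n \<Longrightarrow> \<mu> j \<le> \<mu> i" by (rule spectral_theorem[OF G]) blast
  have "0 \<le> \<mu> j" if "j < n" for j unfolding gram_eigenvalue[OF A U that] by (simp add: sum_nonneg)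
  moreover have "det (A\<^sup>\<dagger> * A) = of_real (\<Prod>j<n. \<mu> j)" "trace (A\<^sup>\<dagger> * A) = of_real (\<Sum>j<n. \<mu> j)"
    unfolding U(2) det_unitary_conj[OF U(1) mat_diag_dim] trace_unitary_conj[OF U(1) mat_diag_dim]
    by (simp_all add: det_mat_diag trace_mat_diag)
  ultimately show ?thesis using that[OF U dec] by (simp del: of_real_prod of_real_sum)
qed

lemma det_gram_nonneg:
  assumes "A \<in> carrier_mat m n" shows "0 \<le> Re (det (A\<^sup>\<dagger> * A))"
proof -
  obtain \<mu> :: "nat \<Rightarrow> real" where "\<And>j. j < n \<Longrightarrow> 0 \<le> \<mu> j" "Re (det (A\<^sup>\<dagger> * A)) = (\<Prod>j<n. \<mu> j)"
    by (rule gram_spectral[OF assms]) blast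
  then show ?thesis by (auto intro!: prod_nonneg)
qed

lemma bij_betw_pick:
  assumes "finite J" shows "bij_betw (pick J) {..<card J} J"
proof (rule bij_betwI')
  show "pick J a = pick J b \<longleftrightarrow> a = b" if "a \<in> {..<card J}" "b \<in> {..<card J}" for a b
    using pick_mono_le[of a J b] pick_mono_le[of b J a] that
    by (cases a b rule: linorder_cases) auto
  show "pick J a \<in> J" if "a \<in> {..<card J}" for a using that by (simp add: pick_in_set_le)
  show "\<exists>a\<in>{..<card J}. j = pick J a" if "j \<in> J" for j
  proof
    show "j = pick J (card {a \<in> J. a < j})" using pick_card_in_set[OF that] by simp
    have "card {a \<in> J. a < j} < card J" using that assms by (intro psubset_card_mono) auto
    then show "card {a \<in> J. a < j} \<in> {..<card J}" by simp
  qed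
qed

lemma submatrix_rows:
  assumes "A \<in> carrier_mat n m" "J \<subseteq> {..<n}"
  shows "submatrix A J UNIV = mat (card J) m (\<lambda>(b,c). A $$ (pick J b, c))"
proof -
  have "{i. i < dim_row A \<and> i \<in> J} = J" using assms by auto
  then show ?thesis using assms(1) by (simp add: submatrix_def pick_UNIV)
qed

lemma submatrix_rows_mult:
  assumes A: "A \<in> carrier_mat n m" and B: "B \<in> carrier_mat m l" and J: "J \<subseteq> {..<n}"
  shows "submatrix (A * B) J UNIV = submatrix A J UNIV * B"
proof (rule eq_matI)
  fix i j assume "i < dim_row (submatrix A J UNIV * B)" "j < dim_col (submatrix A J UNIV * B)"
  then have ij: "i < card J" "j < l" using B by (simp_all add: submatrix_rows[OF A J])
  then have "pick J i < n" using pick_in_set_le[OF ij(1)] J by blast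
  then show "submatrix (A * B) J UNIV $$ (i,j) = (submatrix A J UNIV * B) $$ (i,j)"
    using A B ij by (simp add: submatrix_rows[OF mult_carrier_mat[OF A B] J] submatrix_rows[OF A J]
        index_mult_mat_sum del: index_mult_mat(1))
qed (use B in \<open>simp_all add: submatrix_rows[OF mult_carrier_mat[OF A B] J] submatrix_rows[OF A J]\<close>)

lemma det_submatrix_diag_mult:
  assumes A: "A \<in> carrier_mat n k" and J: "J \<subseteq> {..<n}" "card J = k"
  shows "det (submatrix (mat_diag n f * A) J UNIV) = (\<Prod>j\<in>J. f j) * det (submatrix A J UNIV)"
proof -
  have bij: "bij_betw (pick J) {..<k} J" using bij_betw_pick[of J] J finite_subset by auto
  have S: "submatrix A J UNIV \<in> carrier_mat k k" by (simp add: submatrix_rows[OF A J(1)] J(2))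
  have "submatrix (mat_diag n f * A) J UNIV = mat_diag k (f \<circ> pick J) * submatrix A J UNIV"
  proof (rule eq_matI)
    fix b c assume "b < dim_row (mat_diag k (f \<circ> pick J) * submatrix A J UNIV)"
      "c < dim_col (mat_diag k (f \<circ> pick J) * submatrix A J UNIV)"
    then have bc: "b < k" "c < k" using S by simp_all
    then have "pick J b < n" using bij J(1) by (auto simp: bij_betw_def)
    then have "submatrix (mat_diag n f * A) J UNIV $$ (b,c) = f (pick J b) * A $$ (pick J b, c)"
      unfolding submatrix_rows[OF mult_carrier_mat[OF mat_diag_dim A] J(1)]
      using bc J(2) by (simp add: mat_diag_mult_left[OF A])
    also have "A $$ (pick J b, c) = submatrix A J UNIV $$ (b,c)"
      using bc J(2) by (simp add: submatrix_rows[OF A J(1)])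
    also have "f (pick J b) * \<dots> = (mat_diag k (f \<circ> pick J) * submatrix A J UNIV) $$ (b,c)"
      using bc by (simp add: mat_diag_mult_left[OF S])
    finally show "submatrix (mat_diag n f * A) J UNIV $$ (b,c)
        = (mat_diag k (f \<circ> pick J) * submatrix A J UNIV) $$ (b,c)" .
  qed (use S J(2) in \<open>simp_all add: submatrix_rows[OF mult_carrier_mat[OF mat_diag_dim A] J(1)]\<close>)
  then have "det (submatrix (mat_diag n f * A) J UNIV)
      = (\<Prod>b<k. f (pick J b)) * det (submatrix A J UNIV)"
    using S by (simp add: det_mult[OF mat_diag_dim S] det_mat_diag)
  then show ?thesis using prod.reindex_bij_betw[OF bij, of f] by simp
qed

lemma det_gram_mult:
  assumes A: "A \<in> carrier_mat m n" and F: "F \<in> carrier_mat n n"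
  shows "det ((A * F)\<^sup>\<dagger> * (A * F)) = of_real ((cmod (det F))\<^sup>2) * det (A\<^sup>\<dagger> * A)"
proof -
  have "(A * F)\<^sup>\<dagger> * (A * F) = F\<^sup>\<dagger> * (A\<^sup>\<dagger> * A) * F"
    using A F by (simp add: mat_adjoint_mult mult_mat_assoc)
  also have "det \<dots> = det (F\<^sup>\<dagger>) * det (A\<^sup>\<dagger> * A) * det F"
    using A F by (simp add: det_mult[of _ n] mult_carrier_mat[of _ n m])
  finally show ?thesis unfolding complex_norm_square det_mat_adjoint[OF F] by (simp add: mult_ac)
qed

lemma det_gram_square: "F \<in> carrier_mat n n \<Longrightarrow> Re (det (F\<^sup>\<dagger> * F)) = (cmod (det F))\<^sup>2"
  using det_gram_mult[of "1\<^sub>m n" n n F] by simp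

lemma one_le_det_gram:
  assumes A: "A \<in> carrier_mat n k" and J: "J \<subseteq> {..<n}" "submatrix A J UNIV = 1\<^sub>m k"
  shows "1 \<le> Re (det (A\<^sup>\<dagger> * A))"
proof -
  obtain U \<mu> where U: "unitary_mat k U" "A\<^sup>\<dagger> * A = U * real_diag k \<mu> * U\<^sup>\<dagger>"
    and det: "Re (det (A\<^sup>\<dagger> * A)) = (\<Prod>j<k. \<mu> j)"
    by (rule gram_spectral[OF A]) blast
  note Uc = unitary_matD(1)[OF U(1)]
  have card: "card J = k"
    using arg_cong[OF J(2), of dim_row] by (simp add: submatrix_rows[OF A J(1)])
  then have bij: "bij_betw (pick J) {..<k} J" using bij_betw_pick[of J] J(1) finite_subset by auto
  have "submatrix (A * U) J UNIV = U"
    unfolding submatrix_rows_mult[OF A Uc J(1)] J(2) using Uc by simp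
  then have rows: "mat k k (\<lambda>(b,c). (A * U) $$ (pick J b, c)) = U"
    unfolding submatrix_rows[OF mult_carrier_mat[OF A Uc] J(1)] card .
  have "1 \<le> \<mu> j" if j: "j < k" for j
  proof -
    have "1 = (\<Sum>b<k. (cmod (mat k k (\<lambda>(b,c). (A * U) $$ (pick J b, c)) $$ (b,j)))\<^sup>2)"
      unfolding rows by (rule unitary_column_norm[OF U(1) j, symmetric])
    also have "\<dots> = (\<Sum>b<k. (cmod ((A * U) $$ (pick J b, j)))\<^sup>2)"
      using j by (simp del: index_mult_mat(1))
    also have "\<dots> = (\<Sum>i\<in>J. (cmod ((A * U) $$ (i,j)))\<^sup>2)" by (rule sum.reindex_bij_betw[OF bij])
    also have "\<dots> \<le> (\<Sum>i<n. (cmod ((A * U) $$ (i,j)))\<^sup>2)" using J(1) by (intro sum_mono2) auto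
    finally show ?thesis unfolding gram_eigenvalue[OF A U j] .
  qed
  then show ?thesis unfolding det by (intro prod_ge_1) simp
qed

lemma obtain_mat_inverse:
  assumes "A \<in> carrier_mat n n" "det A \<noteq> (0::complex)"
  obtains B where "B \<in> carrier_mat n n" "A * B = 1\<^sub>m n" "B * A = 1\<^sub>m n"
  using det_non_zero_imp_unit[OF assms, of "()"] by (auto simp: Units_def ring_mat_def)

text \<open>By the Cauchy-Binet formula the right-hand side is the sum of the left-hand sides over all \<open>J\<close>.\<close>

lemma norm_minor_squared_le_det_gram:
  assumes A: "A \<in> carrier_mat n k" and J: "J \<subseteq> {..<n}" "card J = k"
  shows "(cmod (det (submatrix A J UNIV)))\<^sup>2 \<le> Re (det (A\<^sup>\<dagger> * A))"
proof (cases "det (submatrix A J UNIV) = 0")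
  case True
  then show ?thesis using det_gram_nonneg[OF A] by simp
next
  case False
  let ?F = "submatrix A J UNIV"
  have F: "?F \<in> carrier_mat k k" by (simp add: submatrix_rows[OF A J(1)] J(2))
  obtain E where E: "E \<in> carrier_mat k k" "?F * E = 1\<^sub>m k" "E * ?F = 1\<^sub>m k"
    by (rule obtain_mat_inverse[OF F False])
  have AE: "A * E \<in> carrier_mat n k" using A E(1) by simp
  have "A * E * ?F = A" using A E F by (simp add: mult_mat_assoc)
  then have "det (A\<^sup>\<dagger> * A) = of_real ((cmod (det ?F))\<^sup>2) * det ((A * E)\<^sup>\<dagger> * (A * E))"
    using det_gram_mult[OF AE F] by simp
  moreover have "1 \<le> Re (det ((A * E)\<^sup>\<dagger> * (A * E)))"
    using one_le_det_gram[OF AE J(1)] submatrix_rows_mult[OF A E(1) J(1)] E(2) by simp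
  then have "(cmod (det ?F))\<^sup>2 * 1 \<le> (cmod (det ?F))\<^sup>2 * Re (det ((A * E)\<^sup>\<dagger> * (A * E)))"
    by (intro mult_left_mono) auto
  ultimately show ?thesis by (simp del: of_real_power)
qed

definition gram_det :: "nat \<Rightarrow> complex mat \<Rightarrow> (nat \<Rightarrow> complex) set \<Rightarrow> real" where
  "gram_det n C W = Re (det ((C * onb n W)\<^sup>\<dagger> * (C * onb n W)))"

lemma csubspace_mat_apply_image:
  assumes "C \<in> carrier_mat n n" "csubspace n W" shows "csubspace n (mat_apply C ` W)"
  using assms cpair.linear_subspace_image[OF linear_mat_apply] mat_apply_in_cspace by blast

lemma dim_mat_apply_image:
  assumes "C \<in> carrier_mat n n" "det C \<noteq> 0" "csubspace n W"
  shows "cvec.dim (mat_apply C ` W) = cvec.dim W"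
  using assms det_nonzero_iff_mat_apply_injective[OF assms(1)]
  by (intro dim_linear_image_eq linear_mat_apply) auto

lemma mat_apply_image_cspace:
  assumes "C \<in> carrier_mat n n" "det C \<noteq> 0" shows "mat_apply C ` cspace n = cspace n"
  using csubspace_mat_apply_image[OF assms(1), of "cspace n"]
    dim_mat_apply_image[OF assms, of "cspace n"]
  by (intro subspace_eq_if_dim_le[of _ _ n]) (auto simp: subspace_cspace)

lemma gram_det_nonneg: "C \<in> carrier_mat n n \<Longrightarrow> csubspace n W \<Longrightarrow> 0 \<le> gram_det n C W"
  unfolding gram_det_def by (rule det_gram_nonneg[OF mult_carrier_mat[OF _ onb_carrier]])

lemma gram_det_mult:
  assumes C: "C \<in> carrier_mat n n" "det C \<noteq> 0" and T: "T \<in> carrier_mat n n" and W: "csubspace n W"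
  shows "gram_det n (T * C) W = gram_det n T (mat_apply C ` W) * gram_det n C W"
proof -
  let ?V = "mat_apply C ` W" and ?Q = "onb n W" and ?R = "onb n (mat_apply C ` W)"
    and ?k = "cvec.dim W"
  note V = csubspace_mat_apply_image[OF C(1) W] and dim = dim_mat_apply_image[OF C W]
  have Q: "?Q \<in> carrier_mat n ?k" "?R \<in> carrier_mat n ?k" "?R\<^sup>\<dagger> * ?R = 1\<^sub>m ?k"
    using onb_carrier[OF W] onb_carrier[OF V] onb_isometry[OF V] unfolding dim by simp_all
  have "mat_range (C * ?Q) \<subseteq> mat_range ?R" "dim_row (C * ?Q) = dim_row ?R"
    using mat_range_mult[of C ?Q] C(1) Q mat_range_onb[OF W] mat_range_onb[OF V] by simp_all
  then obtain F where F: "F \<in> carrier_mat (dim_col ?R) (dim_col (C * ?Q))" and CQ: "C * ?Q = ?R * F"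
    by (rule factor_if_mat_range_subset)
  have F: "F \<in> carrier_mat ?k ?k"
    using F unfolding index_mult_mat carrier_matD(2)[OF Q(1)] carrier_matD(2)[OF Q(2)] .
  have "T * C * ?Q = T * ?R * F" using C(1) T Q(1,2) F CQ by (simp add: mult_mat_assoc)
  then have "gram_det n (T * C) W = (cmod (det F))\<^sup>2 * gram_det n T ?V"
    using det_gram_mult[OF mult_carrier_mat[OF T Q(2)] F]
    by (simp add: gram_det_def del: of_real_power)
  moreover have "gram_det n C W = (cmod (det F))\<^sup>2"
    unfolding gram_det_def CQ det_gram_mult[OF Q(2) F] Q(3) by (simp del: of_real_power)
  ultimately show ?thesis by simp
qed

lemma gram_det_le_exp_trace:
  assumes T: "T \<in> carrier_mat n n" and W: "csubspace n W"
  shows "gram_det n T W \<le> exp (Re (trace (T\<^sup>\<dagger> * T * proj n W)) - real (cvec.dim W))"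
proof -
  let ?Q = "onb n W" and ?k = "cvec.dim W"
  have Q: "?Q \<in> carrier_mat n ?k" by (rule onb_carrier[OF W])
  obtain \<mu> :: "nat \<Rightarrow> real" where \<mu>: "\<And>j. j < ?k \<Longrightarrow> 0 \<le> \<mu> j"
    and det: "Re (det ((T * ?Q)\<^sup>\<dagger> * (T * ?Q))) = (\<Prod>j<?k. \<mu> j)"
    and tr: "Re (trace ((T * ?Q)\<^sup>\<dagger> * (T * ?Q))) = (\<Sum>j<?k. \<mu> j)"
    by (rule gram_spectral[OF mult_carrier_mat[OF T Q]]) blast
  have "trace (T\<^sup>\<dagger> * T * proj n W) = trace (T\<^sup>\<dagger> * T * ?Q * ?Q\<^sup>\<dagger>)"
    using T Q by (simp add: proj_def mult_mat_assoc)
  also have "\<dots> = trace (?Q\<^sup>\<dagger> * (T\<^sup>\<dagger> * T * ?Q))" by (rule trace_mult_commute) (use T Q in simp_all)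
  also have "?Q\<^sup>\<dagger> * (T\<^sup>\<dagger> * T * ?Q) = (T * ?Q)\<^sup>\<dagger> * (T * ?Q)"
    using T Q by (simp add: mat_adjoint_mult mult_mat_assoc)
  finally have trace: "Re (trace (T\<^sup>\<dagger> * T * proj n W)) = (\<Sum>j<?k. \<mu> j)" using tr by simp
  have "gram_det n T W = (\<Prod>j<?k. \<mu> j)" unfolding gram_det_def det ..
  also have "\<dots> \<le> (\<Prod>j<?k. exp (\<mu> j - 1))"
    using \<mu> exp_ge_add_one_self[of "\<mu> _ - 1"] by (intro prod_mono) auto
  also have "\<dots> = exp ((\<Sum>j<?k. \<mu> j) - real ?k)" by (simp add: exp_sum[symmetric] sum_subtractf)
  finally show ?thesis unfolding trace .
qed

lemma minor_le_gram_det: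
  assumes C: "C \<in> carrier_mat n n" and U: "unitary_mat n U"
    and spec: "C\<^sup>\<dagger> * C = U * real_diag n \<mu> * U\<^sup>\<dagger>" "\<And>j. j < n \<Longrightarrow> 0 \<le> \<mu> j"
    and W: "csubspace n W" and J: "J \<subseteq> {..<n}" "card J = cvec.dim W"
  shows "(\<Prod>j\<in>J. \<mu> j) * (cmod (det (submatrix (U\<^sup>\<dagger> * onb n W) J UNIV)))\<^sup>2 \<le> gram_det n C W"
proof -
  let ?Q = "onb n W" and ?S = "real_diag n (\<lambda>j. sqrt (\<mu> j))"
  note Q = onb_carrier[OF W]
  note Uc = unitary_matD(1)[OF U]
  have UQ: "U\<^sup>\<dagger> * ?Q \<in> carrier_mat n (cvec.dim W)" using Uc Q by simp
  have "?S * ?S = real_diag n \<mu>" using spec(2) by (rule real_diag_sqrt_squared)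
  then have "(?S * (U\<^sup>\<dagger> * ?Q))\<^sup>\<dagger> * (?S * (U\<^sup>\<dagger> * ?Q)) = ?Q\<^sup>\<dagger> * (U * real_diag n \<mu> * U\<^sup>\<dagger>) * ?Q"
    using Uc Q
    by (simp add: mat_adjoint_mult mult_mat_assoc mult_mat_assoc[of ?S ?S, symmetric] del: mat_diag_diag)
  also have "\<dots> = (C * ?Q)\<^sup>\<dagger> * (C * ?Q)"
    unfolding spec(1)[symmetric] using C Q by (simp add: mat_adjoint_mult mult_mat_assoc)
  finally have "gram_det n C W = Re (det ((?S * (U\<^sup>\<dagger> * ?Q))\<^sup>\<dagger> * (?S * (U\<^sup>\<dagger> * ?Q))))"
    by (simp add: gram_det_def)
  also have "\<dots> \<ge> (cmod (det (submatrix (?S * (U\<^sup>\<dagger> * ?Q)) J UNIV)))\<^sup>2"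
    by (rule norm_minor_squared_le_det_gram[OF mult_carrier_mat[OF mat_diag_dim UQ] J])
  also have "(cmod (det (submatrix (?S * (U\<^sup>\<dagger> * ?Q)) J UNIV)))\<^sup>2
      = (\<Prod>j\<in>J. (cmod (complex_of_real (sqrt (\<mu> j))))\<^sup>2) * (cmod (det (submatrix (U\<^sup>\<dagger> * ?Q) J UNIV)))\<^sup>2"
    unfolding det_submatrix_diag_mult[OF UQ J]
    by (simp add: norm_mult power_mult_distrib prod_norm[symmetric] prod_power_distrib)
  also have "(\<Prod>j\<in>J. (cmod (complex_of_real (sqrt (\<mu> j))))\<^sup>2) = (\<Prod>j\<in>J. \<mu> j)"
    using J(1) spec(2) by (intro prod.cong) auto
  finally show ?thesis .
qed

section \<open>Pivots of a subspace\<close>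

definition pivots :: "(nat \<Rightarrow> complex) set \<Rightarrow> nat set" where
  "pivots W = {j. \<exists>w\<in>W. w j \<noteq> 0 \<and> (\<forall>i<j. w i = 0)}"

definition truncate_fun :: "nat \<Rightarrow> (nat \<Rightarrow> complex) \<Rightarrow> nat \<Rightarrow> complex" where
  "truncate_fun m w = (\<lambda>i. if i < m then w i else 0)"

lemma linear_truncate: "clinear (truncate_fun m)"
  by (rule clinearI) (auto simp: truncate_fun_def fun_eq_iff)

lemma truncate_image_cspace: "m \<le> n \<Longrightarrow> truncate_fun m ` cspace n = cspace m"
  by (auto simp: truncate_fun_def cspace_def image_iff fun_eq_iff intro!: exI)

lemma pivots_subset: "W \<subseteq> cspace n \<Longrightarrow> pivots W \<subseteq> {..<n}"
proof
  fix j assume W: "W \<subseteq> cspace n" and "j \<in> pivots W"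
  then obtain w where "w \<in> cspace n" "w j \<noteq> 0" by (auto simp: pivots_def)
  then show "j \<in> {..<n}" by (auto simp: cspace_def not_le[symmetric])
qed

lemma pivots_truncate: "pivots (truncate_fun m ` W) = pivots W \<inter> {..<m}"
proof (rule Set.set_eqI)
  fix j
  have "truncate_fun m w j \<noteq> 0 \<and> (\<forall>i<j. truncate_fun m w i = 0)
      \<longleftrightarrow> j < m \<and> w j \<noteq> 0 \<and> (\<forall>i<j. w i = 0)" for w
    by (auto simp: truncate_fun_def)
  then show "j \<in> pivots (truncate_fun m ` W) \<longleftrightarrow> j \<in> pivots W \<inter> {..<m}"
    by (simp add: pivots_def) blast
qed

lemma least_nonzero_in_pivots:
  assumes "w \<in> W" "w \<noteq> 0"
  obtains j where "j \<in> pivots W" "w j \<noteq> 0"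
proof -
  obtain i where "w i \<noteq> 0" using assms(2) by (auto simp: fun_eq_iff)
  then have "w (LEAST j. w j \<noteq> 0) \<noteq> 0" by (rule LeastI)
  moreover have "(LEAST j. w j \<noteq> 0) \<in> pivots W"
    using assms(1) calculation not_less_Least unfolding pivots_def by blast
  ultimately show ?thesis using that by blast
qed

lemma independent_if_distinct_pivots:
  assumes "finite J" "\<And>j. j \<in> J \<Longrightarrow> w j j \<noteq> 0" "\<And>i j. j \<in> J \<Longrightarrow> i < j \<Longrightarrow> w j i = 0"
  shows "cvec.independent (w ` J) \<and> card (w ` J) = card J"
  using assms
proof (induction J rule: finite_linorder_min_induct)
  case empty
  show ?case using cvec.independent_empty by (simp only: image_empty card.empty simp_thms)
next
  case (insert j J)
  have "cvec.subspace {x. x j = 0}" by (auto simp: cvec.subspace_def)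
  moreover have "w ` J \<subseteq> {x. x j = 0}" using insert by auto
  ultimately have "cvec.span (w ` J) \<subseteq> {x. x j = 0}" by (intro cvec.span_minimal)
  then have notin: "w j \<notin> cvec.span (w ` J)" using insert.prems(1)[of j] by auto
  have IH: "cvec.independent (w ` J)" "card (w ` J) = card J" using insert by blast+
  have "cvec.independent (w ` insert j J)"
    unfolding image_insert by (rule cvec.independent_insertI[OF notin IH(1)])
  moreover have "w j \<notin> w ` J" "j \<notin> J" using notin cvec.span_base insert.hyps(2) by blast+
  then have "card (w ` insert j J) = card (insert j J)" using IH(2) insert.hyps(1) by simp
  ultimately show ?case by blast
qed

lemma card_pivots:
  assumes "csubspace n W" shows "card (pivots W) = cvec.dim W"
proof (rule antisym)
  let ?J = "pivots W"
  have fin: "finite ?J" using pivots_subset[of W n] assms finite_subset by blast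
  have "\<exists>w\<in>W. w j \<noteq> 0 \<and> (\<forall>i<j. w i = 0)" if "j \<in> ?J" for j using that by (simp add: pivots_def)
  then obtain w where w: "\<And>j. j \<in> ?J \<Longrightarrow> w j \<in> W" "\<And>j. j \<in> ?J \<Longrightarrow> w j j \<noteq> 0"
    "\<And>i j. j \<in> ?J \<Longrightarrow> i < j \<Longrightarrow> w j i = 0" by metis
  have ind: "cvec.independent (w ` ?J)" "card (w ` ?J) = card ?J"
    using independent_if_distinct_pivots[OF fin, of w] w(2,3) by blast+
  have "card ?J = cvec.dim (w ` ?J)" using ind cvec.dim_eq_card_independent by metis
  also have "\<dots> \<le> cvec.dim W"
    using w(1) assms by (intro dim_mono_cspace[of _ n]) (auto intro: cvec.span_base)
  finally show "card ?J \<le> cvec.dim W" .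
  define f where "f x = (\<lambda>b. if b < card ?J then x (pick ?J b) else 0)" for x :: "nat \<Rightarrow> complex"
  have lin: "clinear f" by (rule clinearI) (auto simp: f_def fun_eq_iff)
  have "cvec.dim W = cvec.dim (f ` W)"
  proof (rule dim_linear_image_eq[OF _ lin, symmetric])
    fix x assume x: "x \<in> W" "f x = 0"
    show "x = 0"
    proof (rule ccontr)
      assume "x \<noteq> 0"
      with x(1) obtain j where j: "j \<in> ?J" "x j \<noteq> 0" by (rule least_nonzero_in_pivots)
      then obtain b where "b < card ?J" "pick ?J b = j"
        using bij_betw_imp_surj_on[OF bij_betw_pick[OF fin]] by (metis imageE lessThan_iff)
      then show False using fun_cong[OF x(2), of b] j(2) by (simp add: f_def)
    qed
  qed (use assms in blast)
  also have "\<dots> \<le> card ?J" by (rule dim_le_cspace) (auto simp: f_def cspace_def)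
  finally show "cvec.dim W \<le> card ?J" .
qed

lemma pivot_minor_nonzero:
  assumes A: "A \<in> carrier_mat n k" and inj: "\<And>x. x \<in> cspace k \<Longrightarrow> mat_apply A x = 0 \<Longrightarrow> x = 0"
  shows "det (submatrix A (pivots (mat_range A)) UNIV) \<noteq> 0"
proof -
  let ?W = "mat_range A" and ?J = "pivots (mat_range A)"
  have W: "csubspace n ?W" using subspace_mat_range mat_range_subset_cspace[of A] A by auto
  have J: "?J \<subseteq> {..<n}" using W pivots_subset by blast
  have "cvec.dim ?W = k"
    using dim_linear_image_eq[OF subspace_cspace linear_mat_apply, of k A] inj A
    by (simp add: mat_range_def dim_cspace)
  then have card: "card ?J = k" using card_pivots[OF W] by simp
  then have S: "submatrix A ?J UNIV \<in> carrier_mat k k" by (simp add: submatrix_rows[OF A J])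
  have "x = 0" if x: "x \<in> cspace k" "mat_apply (submatrix A ?J UNIV) x = 0" for x
  proof (rule inj[OF x(1)], rule ccontr)
    assume "mat_apply A x \<noteq> 0"
    moreover have "mat_apply A x \<in> ?W" using x(1) A by (simp add: mat_range_def)
    ultimately obtain j where j: "j \<in> ?J" "mat_apply A x j \<noteq> 0"
      using least_nonzero_in_pivots by blast
    have "pick ?J ` {..<k} = ?J"
      using bij_betw_imp_surj_on[OF bij_betw_pick[of ?J]] finite_subset[OF J] card by simp
    then obtain b where b: "b < k" "pick ?J b = j" using j(1) by (metis imageE lessThan_iff)
    have "mat_apply A x j = mat_apply (submatrix A ?J UNIV) x b"
      using b j(1) J A card by (auto simp: mat_apply_def submatrix_rows[OF A J])
    then show False using j(2) x(2) by simp
  qed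
  then show ?thesis using det_nonzero_iff_mat_apply_injective[OF S] by blast
qed

section \<open>Capacity of semistable arrangements\<close>

lemma abel_sum_nonneg:
  fixes c x :: "nat \<Rightarrow> real"
  assumes decreasing: "\<And>i j. i \<le> j \<Longrightarrow> j < d \<Longrightarrow> x j \<le> x i"
    and partial_sums: "\<And>m. m \<le> d \<Longrightarrow> 0 \<le> (\<Sum>j<m. c j)" and total: "(\<Sum>j<d. c j) = 0"
  shows "0 \<le> (\<Sum>j<d. c j * x j)"
proof -
  have partial: "(\<Sum>j<Suc m. c j) * x m \<le> (\<Sum>j<Suc m. c j * x j)" if "Suc m \<le> d" for m
    using that
  proof (induction m)
    case (Suc m)
    have "(\<Sum>j<Suc m. c j) * x (Suc m) \<le> (\<Sum>j<Suc m. c j) * x m"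
      using Suc.prems partial_sums[of "Suc m"] decreasing[of m "Suc m"]
      by (intro mult_left_mono) auto
    also have "\<dots> \<le> (\<Sum>j<Suc m. c j * x j)" using Suc by simp
    finally show ?case by (simp add: algebra_simps)
  qed simp
  show ?thesis
  proof (cases d)
    case (Suc m)
    then show ?thesis using partial[of m] total by simp
  qed simp
qed

lemma sum_incidences:
  fixes y :: "'j \<Rightarrow> 'a::comm_semiring_1"
  assumes "finite I" "finite A"
  shows "(\<Sum>i\<in>I. \<Sum>j\<in>J i \<inter> A. y j) = (\<Sum>j\<in>A. of_nat (card {i \<in> I. j \<in> J i}) * y j)"
proof -
  have "(\<Sum>i\<in>I. \<Sum>j\<in>J i \<inter> A. y j) = (\<Sum>i\<in>I. \<Sum>j | j \<in> A \<and> j \<in> J i. y j)"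
    by (simp add: Int_def conj_commute)
  also have "\<dots> = (\<Sum>j\<in>A. \<Sum>i | i \<in> I \<and> j \<in> J i. y j)" by (rule sum.swap_restrict[OF assms])
  finally show ?thesis by simp
qed

lemma prod_powr_le_prod_pattern:
  fixes \<mu> :: "nat \<Rightarrow> real"
  assumes I: "finite I" and J: "\<And>i. i \<in> I \<Longrightarrow> J i \<subseteq> {..<d}"
    and pos: "\<And>j. j < d \<Longrightarrow> 0 < \<mu> j" and decreasing: "\<And>i j. i \<le> j \<Longrightarrow> j < d \<Longrightarrow> \<mu> j \<le> \<mu> i"
    and partial: "\<And>m. m \<le> d \<Longrightarrow> \<sigma> * real m \<le> (\<Sum>i\<in>I. real (card (J i \<inter> {..<m})))"
    and total: "(\<Sum>i\<in>I. real (card (J i))) = \<sigma> * real d"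
  shows "(\<Prod>j<d. \<mu> j) powr \<sigma> \<le> (\<Prod>i\<in>I. \<Prod>j\<in>J i. \<mu> j)"
proof -
  define c where "c j = real (card {i \<in> I. j \<in> J i}) - \<sigma>" for j
  have Int: "J i \<inter> {..<d} = J i" if "i \<in> I" for i using J[OF that] by blast
  have sum_c: "(\<Sum>j<m. c j) = (\<Sum>i\<in>I. real (card (J i \<inter> {..<m}))) - \<sigma> * real m" for m
    using sum_incidences[OF I, of "{..<m}" "\<lambda>_. 1::real" J] by (simp add: c_def sum_subtractf)
  have "0 \<le> (\<Sum>j<d. c j * ln (\<mu> j))"
  proof (rule abel_sum_nonneg)
    show "ln (\<mu> j) \<le> ln (\<mu> i)" if "i \<le> j" "j < d" for i j using that pos decreasing by simp
    show "0 \<le> (\<Sum>j<m. c j)" if "m \<le> d" for m unfolding sum_c using partial[OF that] by simp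
    show "(\<Sum>j<d. c j) = 0" unfolding sum_c using total Int by simp
  qed
  moreover have "(\<Sum>i\<in>I. \<Sum>j\<in>J i. ln (\<mu> j)) = (\<Sum>j<d. real (card {i \<in> I. j \<in> J i}) * ln (\<mu> j))"
    using sum_incidences[OF I, of "{..<d}" "\<lambda>j. ln (\<mu> j)" J] Int by simp
  ultimately have "\<sigma> * (\<Sum>j<d. ln (\<mu> j)) \<le> (\<Sum>i\<in>I. \<Sum>j\<in>J i. ln (\<mu> j))"
    by (simp add: c_def left_diff_distrib sum_subtractf sum_distrib_left)
  then have "exp (\<sigma> * (\<Sum>j<d. ln (\<mu> j))) \<le> exp (\<Sum>i\<in>I. \<Sum>j\<in>J i. ln (\<mu> j))" by simp
  moreover have "exp (\<sigma> * (\<Sum>j<d. ln (\<mu> j))) = (\<Prod>j<d. \<mu> j) powr \<sigma>"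
  proof -
    have "(\<Sum>j<d. ln (\<mu> j)) = ln (\<Prod>j<d. \<mu> j)" by (subst ln_prod) (auto dest: pos)
    then show ?thesis by (auto simp: powr_def dest: pos)
  qed
  moreover have "exp (\<Sum>i\<in>I. \<Sum>j\<in>J i. ln (\<mu> j)) = (\<Prod>i\<in>I. \<Prod>j\<in>J i. \<mu> j)"
  proof -
    have "exp (\<Sum>j\<in>J i. ln (\<mu> j)) = (\<Prod>j\<in>J i. \<mu> j)" if "i \<in> I" for i
      using J[OF that] pos finite_subset[OF J[OF that]] by (subst exp_sum) (auto intro!: prod.cong)
    then show ?thesis using I by (simp add: exp_sum)
  qed
  ultimately show ?thesis by simp
qed

lemma continuous_on_det:
  fixes F :: "'a::topological_space \<Rightarrow> nat \<Rightarrow> nat \<Rightarrow> complex"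
  assumes "\<And>a b. a < k \<Longrightarrow> b < k \<Longrightarrow> continuous_on S (\<lambda>x. F x a b)"
  shows "continuous_on S (\<lambda>x. det (mat k k (\<lambda>(a,b). F x a b)))"
proof -
  have less: "p a < k" if "p permutes {0..<k}" "a < k" for p a
    using permutes_in_image[OF that(1), of a] that(2) by simp
  have "det (mat k k (\<lambda>(a,b). F x a b))
      = (\<Sum>p | p permutes {0..<k}. signof p * (\<Prod>a = 0..<k. F x a (p a)))" for x
    by (subst det_def'[of _ k]) (auto intro!: sum.cong prod.cong simp: less)
  moreover have "continuous_on S (\<lambda>x. \<Sum>p | p permutes {0..<k}. signof p * (\<Prod>a = 0..<k. F x a (p a)))"
    by (intro continuous_intros) (auto intro!: assms simp: less)
  ultimately show ?thesis by simp
qed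

lemma compact_functions_into:
  fixes S :: "'b::topological_space set"
  assumes "compact S" shows "compact {f :: 'a \<Rightarrow> 'b. \<forall>x. f x \<in> S}"
proof -
  have "compactin (product_topology (\<lambda>_. euclidean) UNIV) (PiE UNIV (\<lambda>_::'a. S))"
    using assms by (subst compactin_PiE) auto
  moreover have "PiE UNIV (\<lambda>_::'a. S) = {f. \<forall>x. f x \<in> S}" by (auto simp: PiE_def)
  ultimately show ?thesis by (simp add: euclidean_product_topology)
qed

lemma compact_complex_square: "compact {z. \<bar>Re z\<bar> \<le> 1 \<and> \<bar>Im z\<bar> \<le> 1}"
proof -
  have "{z. \<bar>Re z\<bar> \<le> 1 \<and> \<bar>Im z\<bar> \<le> 1} = (\<lambda>(x,y). Complex x y) ` ({-1..1} \<times> {-1..1})"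
  proof (intro equalityI subsetI)
    fix z assume "z \<in> {z. \<bar>Re z\<bar> \<le> 1 \<and> \<bar>Im z\<bar> \<le> 1}"
    then show "z \<in> (\<lambda>(x,y). Complex x y) ` ({-1..1} \<times> {-1..1})"
      by (intro image_eqI[of _ _ "(Re z, Im z)"]) (auto simp: abs_le_iff)
  qed auto
  moreover have "compact ((\<lambda>(x,y). Complex x y) ` ({-1..1} \<times> {-1..1}))"
    by (intro compact_continuous_image compact_Times compact_Icc)
      (auto simp: case_prod_unfold Complex_eq intro!: continuous_intros)
  ultimately show ?thesis by simp
qed

lemma unitary_entries_in_compact:
  obtains K :: "(nat \<times> nat \<Rightarrow> complex) set"
    where "compact K" "\<And>f. f \<in> K \<Longrightarrow> det (mat d d f) \<noteq> 0"
      "\<And>V. unitary_mat d V \<Longrightarrow> \<exists>f\<in>K. mat d d f = V"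
proof
  let ?S = "{z. \<bar>Re z\<bar> \<le> 1 \<and> \<bar>Im z\<bar> \<le> 1}"
  define K where "K = {f :: nat \<times> nat \<Rightarrow> complex. \<forall>p. f p \<in> ?S} \<inter> {f. cmod (det (mat d d f)) = 1}"
  have "continuous_on UNIV (\<lambda>f :: nat \<times> nat \<Rightarrow> complex. det (mat d d (\<lambda>(a,b). f (a,b))))"
    by (intro continuous_on_det continuous_on_product_coordinates)
  then have "continuous_on UNIV (\<lambda>f :: nat \<times> nat \<Rightarrow> complex. cmod (det (mat d d f)))"
    by (intro continuous_intros) simp
  then have "closed {f :: nat \<times> nat \<Rightarrow> complex. cmod (det (mat d d f)) = 1}"
    by (intro closed_Collect_eq) auto
  then show "compact K"
    unfolding K_def by (intro compact_Int_closed compact_functions_into compact_complex_square)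
  show "det (mat d d f) \<noteq> 0" if "f \<in> K" for f using that by (auto simp: K_def)
  show "\<exists>f\<in>K. mat d d f = V" if V: "unitary_mat d V" for V
  proof
    define f where "f p = (if fst p < d \<and> snd p < d then V $$ p else 0)" for p
    show eq: "mat d d f = V" using V by (intro eq_matI) (auto simp: unitary_mat_def f_def)
    have "cmod (f p) \<le> 1" for p using norm_index_unitary_le_1[OF V] by (cases p) (simp add: f_def)
    then have "f p \<in> ?S" for p
      using abs_Re_le_cmod[of "f p"] abs_Im_le_cmod[of "f p"] order_trans by blast
    then show "f \<in> K" unfolding K_def using norm_det_unitary[OF V] eq by blast
  qed
qed

text \<open>The surjections \<open>S\<close> stand for the quotients of the ambient space, none of which has slope below \<open>\<sigma>\<close>.\<close>

locale semistable_arrangement =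
  fixes I :: "'i set" and W :: "'i \<Rightarrow> (nat \<Rightarrow> complex) set" and d :: nat and \<sigma> :: real
  assumes finite_I: "finite I" and W: "\<And>i. i \<in> I \<Longrightarrow> csubspace d (W i)"
    and span_W: "cvec.span (\<Union>i\<in>I. W i) = cspace d" and d_pos: "0 < d"
    and slope: "(\<Sum>i\<in>I. real (cvec.dim (W i))) = \<sigma> * real d"
    and semistable: "\<And>S m. clinear S \<Longrightarrow> S ` cspace d = cspace m \<Longrightarrow>
      \<sigma> * real m \<le> (\<Sum>i\<in>I. real (cvec.dim (S ` W i)))"
begin

definition pivot_patterns :: "('i \<Rightarrow> nat set) set" where
  "pivot_patterns = {J \<in> PiE I (\<lambda>_. Pow {..<d}). (\<forall>i\<in>I. card (J i) = cvec.dim (W i)) \<and>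
     (\<forall>m\<le>d. \<sigma> * real m \<le> (\<Sum>i\<in>I. real (card (J i \<inter> {..<m}))))}"

definition pattern_weight :: "complex mat \<Rightarrow> ('i \<Rightarrow> nat set) \<Rightarrow> real" where
  "pattern_weight V J = (\<Prod>i\<in>I. (cmod (det (submatrix (V * onb d (W i)) (J i) UNIV)))\<^sup>2)"

lemma pivot_patternD:
  assumes "J \<in> pivot_patterns" "i \<in> I" shows "J i \<subseteq> {..<d}" "card (J i) = cvec.dim (W i)"
  using assms by (auto simp: pivot_patterns_def)

lemma finite_pivot_patterns: "finite pivot_patterns"
  unfolding pivot_patterns_def
  by (rule finite_subset[of _ "PiE I (\<lambda>_. Pow {..<d})"]) (auto intro!: finite_PiE finite_I)

lemma pattern_weight_nonneg: "0 \<le> pattern_weight V J"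
  unfolding pattern_weight_def by (intro prod_nonneg) auto

lemma sum_card_pivots_truncated:
  assumes V: "V \<in> carrier_mat d d" "det V \<noteq> 0" and m: "m \<le> d"
  shows "\<sigma> * real m \<le> (\<Sum>i\<in>I. real (card (pivots (mat_apply V ` W i) \<inter> {..<m})))"
proof -
  have "(truncate_fun m \<circ> mat_apply V) ` cspace d = cspace m"
    unfolding image_comp[symmetric]
    using mat_apply_image_cspace[OF V] truncate_image_cspace[OF m] by simp
  then have "\<sigma> * real m \<le> (\<Sum>i\<in>I. real (cvec.dim ((truncate_fun m \<circ> mat_apply V) ` W i)))"
    by (intro semistable Vector_Spaces.linear_compose[OF linear_mat_apply linear_truncate])
  also have "\<dots> = (\<Sum>i\<in>I. real (card (pivots (mat_apply V ` W i) \<inter> {..<m})))"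
  proof (intro sum.cong refl arg_cong[of _ _ real])
    fix i assume i: "i \<in> I"
    have "csubspace m (truncate_fun m ` mat_apply V ` W i)"
      using csubspace_mat_apply_image[OF V(1) W[OF i]]
        cpair.linear_subspace_image[OF linear_truncate]
      by (auto simp: truncate_fun_def cspace_def)
    then show "cvec.dim ((truncate_fun m \<circ> mat_apply V) ` W i)
        = card (pivots (mat_apply V ` W i) \<inter> {..<m})"
      unfolding pivots_truncate[symmetric] image_comp[symmetric] by (rule card_pivots[symmetric])
  qed
  finally show ?thesis .
qed

lemma pivots_in_pivot_patterns:
  assumes V: "V \<in> carrier_mat d d" "det V \<noteq> 0"
  shows "(\<lambda>i\<in>I. pivots (mat_apply V ` W i)) \<in> pivot_patterns"
proof -
  have "pivots (mat_apply V ` W i) \<subseteq> {..<d}"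
    "card (pivots (mat_apply V ` W i)) = cvec.dim (W i)" if "i \<in> I" for i
    using csubspace_mat_apply_image[OF V(1) W[OF that]] dim_mat_apply_image[OF V W[OF that]]
      pivots_subset card_pivots by auto
  then show ?thesis using sum_card_pivots_truncated[OF V] by (auto simp: pivot_patterns_def)
qed

lemma pattern_weight_pivots_pos:
  assumes V: "V \<in> carrier_mat d d" "det V \<noteq> 0"
  shows "0 < pattern_weight V (\<lambda>i\<in>I. pivots (mat_apply V ` W i))"
  unfolding pattern_weight_def
proof (intro prod_pos)
  fix i assume i: "i \<in> I"
  note Q = onb_carrier[OF W[OF i]] onb_isometry[OF W[OF i]]
  have "det (submatrix (V * onb d (W i)) (pivots (mat_range (V * onb d (W i)))) UNIV) \<noteq> 0"
  proof (rule pivot_minor_nonzero[OF mult_carrier_mat[OF V(1) Q(1)]])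
    fix x assume x: "x \<in> cspace (cvec.dim (W i))" "mat_apply (V * onb d (W i)) x = 0"
    then have "mat_apply V (mat_apply (onb d (W i)) x) = 0"
      using V(1) Q(1) by (simp add: mat_apply_mult)
    then have "mat_apply (onb d (W i)) x = 0"
      using V det_nonzero_iff_mat_apply_injective[OF V(1)] mat_apply_in_cspace[OF Q(1)] by blast
    then show "x = 0" by (rule isometry_injective[OF Q(1,2) x(1)])
  qed
  then show
    "0 < (cmod (det (submatrix (V * onb d (W i)) ((\<lambda>i\<in>I. pivots (mat_apply V ` W i)) i) UNIV)))\<^sup>2"
    using mat_range_mult[of V "onb d (W i)"] V(1) Q(1) mat_range_onb[OF W[OF i]] i by simp
qed

lemma continuous_pattern_weight:
  assumes J: "J \<in> pivot_patterns"
  shows "continuous_on UNIV (\<lambda>f. pattern_weight (mat d d f) J)"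
  unfolding pattern_weight_def
proof (intro continuous_intros)
  fix i assume i: "i \<in> I"
  let ?Q = "onb d (W i)" and ?k = "cvec.dim (W i)"
  note Q = onb_carrier[OF W[OF i]]
  have "submatrix (mat d d f * ?Q) (J i) UNIV
      = mat ?k ?k (\<lambda>(b,c). \<Sum>a<d. f (pick (J i) b, a) * ?Q $$ (a,c))" for f
  proof (rule eq_matI)
    fix b c assume "b < dim_row (mat ?k ?k (\<lambda>(b,c). \<Sum>a<d. f (pick (J i) b, a) * ?Q $$ (a,c)))"
      "c < dim_col (mat ?k ?k (\<lambda>(b,c). \<Sum>a<d. f (pick (J i) b, a) * ?Q $$ (a,c)))"
    then have bc: "b < card (J i)" "b < ?k" "c < ?k" using pivot_patternD(2)[OF J i] by simp_all
    then have "pick (J i) b < d" using pick_in_set_le[OF bc(1)] pivot_patternD(1)[OF J i] by blast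
    then show "submatrix (mat d d f * ?Q) (J i) UNIV $$ (b,c)
        = mat ?k ?k (\<lambda>(b,c). \<Sum>a<d. f (pick (J i) b, a) * ?Q $$ (a,c)) $$ (b,c)"
      unfolding submatrix_rows[OF mult_carrier_mat[OF mat_carrier Q] pivot_patternD(1)[OF J i]]
      using bc Q by (simp add: index_mult_mat_sum del: index_mult_mat(1))
  qed (simp_all add: pivot_patternD(2)[OF J i]
      submatrix_rows[OF mult_carrier_mat[OF mat_carrier Q] pivot_patternD(1)[OF J i]])
  moreover have "continuous_on UNIV (\<lambda>f. det (mat ?k ?k (\<lambda>(b,c). \<Sum>a<d. f (pick (J i) b, a) * ?Q $$ (a,c))))"
    by (intro continuous_on_det continuous_intros continuous_on_product_coordinates)
  ultimately show "continuous_on UNIV (\<lambda>f. det (submatrix (mat d d f * ?Q) (J i) UNIV))" by simp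
qed

lemma sum_pattern_weight_bounded_below:
  obtains c where "0 < c" "\<And>V. unitary_mat d V \<Longrightarrow> c \<le> (\<Sum>J\<in>pivot_patterns. pattern_weight V J)"
proof -
  obtain K :: "(nat \<times> nat \<Rightarrow> complex) set" where K: "compact K" "\<And>f. f \<in> K \<Longrightarrow> det (mat d d f) \<noteq> 0"
    and unitary: "\<And>V. unitary_mat d V \<Longrightarrow> \<exists>f\<in>K. mat d d f = V"
    by (rule unitary_entries_in_compact) blast
  define g where "g f = (\<Sum>J\<in>pivot_patterns. pattern_weight (mat d d f) J)" for f
  have "continuous_on UNIV g" unfolding g_def by (intro continuous_intros continuous_pattern_weight)
  then have cont: "continuous_on K g" by (rule continuous_on_subset) simp
  have "unitary_mat d (1\<^sub>m d)" by (simp add: unitary_mat_def)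
  then have "K \<noteq> {}" using unitary by blast
  from continuous_attains_inf[OF K(1) this cont]
  obtain f where f: "f \<in> K" "\<forall>h\<in>K. g f \<le> g h" by blast
  show ?thesis
  proof (rule that)
    have det: "mat d d f \<in> carrier_mat d d" "det (mat d d f) \<noteq> 0" using K(2)[OF f(1)] by simp_all
    show "0 < g f" unfolding g_def
    proof (rule sum_pos2[OF finite_pivot_patterns pivots_in_pivot_patterns[OF det]])
      show "0 < pattern_weight (mat d d f) (\<lambda>i\<in>I. pivots (mat_apply (mat d d f) ` W i))"
        by (rule pattern_weight_pivots_pos[OF det])
    qed (rule pattern_weight_nonneg)
    show "g f \<le> (\<Sum>J\<in>pivot_patterns. pattern_weight V J)" if "unitary_mat d V" for V
      using f(2) unitary[OF that] unfolding g_def by blast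
  qed
qed

lemma pattern_weight_bounded_below:
  obtains c where "0 < c" "\<And>V. unitary_mat d V \<Longrightarrow> \<exists>J\<in>pivot_patterns. c \<le> pattern_weight V J"
proof -
  obtain c where c: "0 < c" "\<And>V. unitary_mat d V \<Longrightarrow> c \<le> (\<Sum>J\<in>pivot_patterns. pattern_weight V J)"
    by (rule sum_pattern_weight_bounded_below) blast
  have "unitary_mat d (1\<^sub>m d)" by (simp add: unitary_mat_def)
  then have "pivot_patterns \<noteq> {}" using c by force
  then have card: "0 < real (card pivot_patterns)"
    using finite_pivot_patterns by (simp add: card_gt_0_iff)
  have "\<exists>J\<in>pivot_patterns. c / real (card pivot_patterns) \<le> pattern_weight V J"
    if "unitary_mat d V" for V
  proof (rule ccontr)
    assume "\<not> ?thesis"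
    then have "(\<Sum>J\<in>pivot_patterns. pattern_weight V J)
        < (\<Sum>J\<in>pivot_patterns. c / real (card pivot_patterns))"
      using \<open>pivot_patterns \<noteq> {}\<close> finite_pivot_patterns
      by (intro sum_strict_mono) (auto simp: not_le)
    then show False using c(2)[OF that] card by simp
  qed
  with c(1) card that[of "c / real (card pivot_patterns)"] show ?thesis by simp
qed

text \<open>In an eigenbasis of \<open>C\<^sup>\<dagger> C\<close> each Gram determinant is at least one term of its Cauchy-Binet expansion;
  the pivot inequalities of a pivot pattern turn the product of these terms into a power of \<open>det C\<close>.\<close>

lemma pattern_weight_le_prod_gram_det:
  assumes C: "C \<in> carrier_mat d d" and U: "unitary_mat d U"
    and spec: "C\<^sup>\<dagger> * C = U * real_diag d \<mu> * U\<^sup>\<dagger>"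
    and pos: "\<And>j. j < d \<Longrightarrow> 0 < \<mu> j" and decreasing: "\<And>i j. i \<le> j \<Longrightarrow> j < d \<Longrightarrow> \<mu> j \<le> \<mu> i"
    and J: "J \<in> pivot_patterns"
  shows "pattern_weight (U\<^sup>\<dagger>) J * (\<Prod>j<d. \<mu> j) powr \<sigma> \<le> (\<Prod>i\<in>I. gram_det d C (W i))"
proof -
  note nonneg = less_imp_le[OF pos]
  have "(\<Prod>j<d. \<mu> j) powr \<sigma> \<le> (\<Prod>i\<in>I. \<Prod>j\<in>J i. \<mu> j)"
    using J slope pivot_patternD[OF J]
    by (intro prod_powr_le_prod_pattern finite_I pos decreasing) (auto simp: pivot_patterns_def)
  then have "pattern_weight (U\<^sup>\<dagger>) J * (\<Prod>j<d. \<mu> j) powr \<sigma>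
      \<le> pattern_weight (U\<^sup>\<dagger>) J * (\<Prod>i\<in>I. \<Prod>j\<in>J i. \<mu> j)"
    by (rule mult_left_mono[OF _ pattern_weight_nonneg])
  also have "\<dots> = (\<Prod>i\<in>I. (\<Prod>j\<in>J i. \<mu> j) * (cmod (det (submatrix (U\<^sup>\<dagger> * onb d (W i)) (J i) UNIV)))\<^sup>2)"
    by (simp add: pattern_weight_def prod.distrib mult.commute)
  also have "\<dots> \<le> (\<Prod>i\<in>I. gram_det d C (W i))"
    using pivot_patternD(1)[OF J] nonneg
    by (intro prod_mono conjI minor_le_gram_det[OF C U spec] W pivot_patternD[OF J] mult_nonneg_nonneg prod_nonneg)
      (auto simp: subset_iff)
  finally show ?thesis .
qed

lemma capacity_lower_bound:
  obtains c where "0 < c" "\<And>C. C \<in> carrier_mat d d \<Longrightarrow> det C \<noteq> 0 \<Longrightarrow>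
    c * (cmod (det C))\<^sup>2 powr \<sigma> \<le> (\<Prod>i\<in>I. gram_det d C (W i))"
proof -
  obtain c where c: "0 < c" "\<And>V. unitary_mat d V \<Longrightarrow> \<exists>J\<in>pivot_patterns. c \<le> pattern_weight V J"
    by (rule pattern_weight_bounded_below) blast
  have "c * (cmod (det C))\<^sup>2 powr \<sigma> \<le> (\<Prod>i\<in>I. gram_det d C (W i))"
    if C: "C \<in> carrier_mat d d" "det C \<noteq> 0" for C
  proof -
    obtain U \<mu> where U: "unitary_mat d U" and spec: "C\<^sup>\<dagger> * C = U * real_diag d \<mu> * U\<^sup>\<dagger>"
      and \<mu>: "\<And>i j. i \<le> j \<Longrightarrow> j < d \<Longrightarrow> \<mu> j \<le> \<mu> i" "\<And>j. j < d \<Longrightarrow> 0 \<le> \<mu> j"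
      and det: "Re (det (C\<^sup>\<dagger> * C)) = (\<Prod>j<d. \<mu> j)"
      by (rule gram_spectral[OF C(1)]) blast
    have det_C: "(cmod (det C))\<^sup>2 = (\<Prod>j<d. \<mu> j)" using det det_gram_square[OF C(1)] by simp
    then have "(\<Prod>j<d. \<mu> j) \<noteq> 0" using C(2) by (metis norm_eq_zero power_not_zero)
    then have \<mu>_pos: "0 < \<mu> j" if "j < d" for j using \<mu>(2)[OF that] that by (auto simp: less_le)
    obtain J where J: "J \<in> pivot_patterns" "c \<le> pattern_weight (U\<^sup>\<dagger>) J"
      using c(2)[OF unitary_mat_adjoint[OF U]] by blast
    have "c * (cmod (det C))\<^sup>2 powr \<sigma> \<le> pattern_weight (U\<^sup>\<dagger>) J * (\<Prod>j<d. \<mu> j) powr \<sigma>"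
      unfolding det_C by (rule mult_right_mono[OF J(2)]) simp
    also have "\<dots> \<le> (\<Prod>i\<in>I. gram_det d C (W i))"
      by (rule pattern_weight_le_prod_gram_det[OF C(1) U spec \<mu>_pos \<mu>(1) J(1)])
    finally show ?thesis .
  qed
  with c(1) that show ?thesis by blast
qed

end

section \<open>Operator scaling\<close>

lemma squared_dist_one_le_ln_defect:
  fixes x :: real
  assumes "0 < x" "x \<le> B" "1 \<le> B"
  shows "(x - 1)\<^sup>2 \<le> 4 * B * (x - 1 - ln x)"
proof -
  define s where "s = sqrt x"
  have s: "0 < s" "s\<^sup>2 = x" using assms by (auto simp: s_def)
  have "ln x = 2 * ln s" using s by (metis ln_realpow of_nat_numeral)
  also have "\<dots> \<le> 2 * (s - 1)" using ln_le_minus_one[OF s(1)] by simp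
  finally have diff: "(s - 1)\<^sup>2 \<le> x - 1 - ln x" using s by (simp add: power2_eq_square algebra_simps)
  have "s \<le> sqrt B" using assms by (simp add: s_def)
  moreover have "1 \<le> sqrt B" using assms by simp
  ultimately have "s + 1 \<le> 2 * sqrt B" by linarith
  then have "(s + 1)\<^sup>2 \<le> (2 * sqrt B)\<^sup>2" using s by (intro power_mono) auto
  also have "\<dots> = 4 * B" using assms by (simp add: power_mult_distrib)
  finally have sum: "(s + 1)\<^sup>2 \<le> 4 * B" .
  have "(x - 1)\<^sup>2 = (s + 1)\<^sup>2 * (s - 1)\<^sup>2"
    unfolding s(2)[symmetric] by (simp add: power2_eq_square algebra_simps)
  also have "\<dots> \<le> 4 * B * (x - 1 - ln x)" using sum diff assms by (intro mult_mono) auto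
  finally show ?thesis .
qed

lemma sum_squares_le_if_prod_near_one:
  fixes y :: "nat \<Rightarrow> real"
  assumes pos: "\<And>j. j < d \<Longrightarrow> 0 < y j" and sum: "(\<Sum>j<d. y j) = real d"
    and prod: "exp (- 1 / 4) \<le> (\<Prod>j<d. y j)"
  shows "(\<Sum>j<d. (y j)\<^sup>2) \<le> 2 * real d"
proof (cases "d = 0")
  case False
  have le: "y j \<le> real d" if "j < d" for j
    using member_le_sum[of j "{..<d}" y] pos that sum by (auto simp: less_imp_le)
  have "- 1 / 4 \<le> ln (\<Prod>j<d. y j)" using prod pos by (subst ln_ge_iff) (auto intro: prod_pos)
  also have "\<dots> = (\<Sum>j<d. ln (y j))" by (subst ln_prod) (auto dest: pos)
  finally have defect: "(\<Sum>j<d. y j - 1 - ln (y j)) \<le> 1 / 4" using sum by (simp add: sum_subtractf)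
  have "(\<Sum>j<d. (y j - 1)\<^sup>2) \<le> (\<Sum>j<d. 4 * real d * (y j - 1 - ln (y j)))"
    using pos le False by (intro sum_mono squared_dist_one_le_ln_defect) auto
  also have "\<dots> = 4 * real d * (\<Sum>j<d. y j - 1 - ln (y j))" by (simp add: sum_distrib_left)
  also have "\<dots> \<le> real d" using mult_left_mono[OF defect, of "4 * real d"] by simp
  finally have "(\<Sum>j<d. (y j - 1)\<^sup>2) \<le> real d" .
  moreover have "(\<Sum>j<d. (y j - 1)\<^sup>2) = (\<Sum>j<d. (y j)\<^sup>2) - 2 * (\<Sum>j<d. y j) + real d"
    by (simp add: power2_diff sum.distrib sum_subtractf sum_distrib_left)
  ultimately show ?thesis using sum by simp
qed simp

lemma cinner_frame_op:
  "cinner n (mat_apply (frame_op n W I) x) y = (\<Sum>i\<in>I. cinner n (mat_apply (proj n (W i)) x) y)"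
  if "\<And>i. i \<in> I \<Longrightarrow> csubspace n (W i)"
proof -
  have P: "dim_row (proj n (W i)) = n" "dim_col (proj n (W i)) = n" if "i \<in> I" for i
    using proj_carrier[OF \<open>\<And>i. i \<in> I \<Longrightarrow> csubspace n (W i)\<close>[OF that]] by simp_all
  have "mat_apply (frame_op n W I) x a = (\<Sum>i\<in>I. mat_apply (proj n (W i)) x a)" if "a < n" for a
  proof -
    have "mat_apply (frame_op n W I) x a = (\<Sum>b<n. \<Sum>i\<in>I. proj n (W i) $$ (a,b) * x b)"
      using that by (simp add: mat_apply_def frame_op_def sum_distrib_right)
    also have "\<dots> = (\<Sum>i\<in>I. \<Sum>b<n. proj n (W i) $$ (a,b) * x b)" by (rule sum.swap)
    finally show ?thesis using that by (simp add: mat_apply_def P)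
  qed
  then have "cinner n (mat_apply (frame_op n W I) x) y
      = (\<Sum>a<n. \<Sum>i\<in>I. mat_apply (proj n (W i)) x a * cnj (y a))"
    by (simp add: cinner_def sum_distrib_right)
  also have "\<dots> = (\<Sum>i\<in>I. \<Sum>a<n. mat_apply (proj n (W i)) x a * cnj (y a))" by (rule sum.swap)
  finally show ?thesis by (simp add: cinner_def)
qed

lemma cinner_proj_self:
  assumes "csubspace n W"
  shows "cinner n (mat_apply (proj n W) x) x
      = cinner n (mat_apply (proj n W) x) (mat_apply (proj n W) x)"
proof -
  have "mat_apply (proj n W) x = mat_apply (proj n W * proj n W) x"
    using proj_mult_proj_if_subset[OF assms assms] by simp
  also have "\<dots> = mat_apply (proj n W) (mat_apply (proj n W) x)"
    using proj_carrier[OF assms] by (intro mat_apply_mult) simp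
  finally show ?thesis
    using cinner_mat_apply[OF proj_carrier[OF assms], of "mat_apply (proj n W) x" x]
    by (simp add: proj_adjoint)
qed

lemma frame_op_positive_definite:
  assumes W: "\<And>i. i \<in> I \<Longrightarrow> csubspace n (W i)" and I: "finite I"
    and span: "cvec.span (\<Union>i\<in>I. W i) = cspace n" and x: "x \<in> cspace n" "x \<noteq> 0"
  shows "0 < Re (cinner n (mat_apply (frame_op n W I) x) x)"
proof (rule ccontr)
  define q where "q i = Re (cinner n (mat_apply (proj n (W i)) x) x)" for i
  have q: "q i = (\<Sum>a<n. (cmod (mat_apply (proj n (W i)) x a))\<^sup>2)" if "i \<in> I" for i
    unfolding q_def cinner_proj_self[OF W[OF that]] cinner_self by simp
  then have q_nonneg: "0 \<le> q i" if "i \<in> I" for i using that by (simp add: sum_nonneg)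
  assume "\<not> 0 < Re (cinner n (mat_apply (frame_op n W I) x) x)"
  then have "(\<Sum>i\<in>I. q i) \<le> 0" by (simp add: cinner_frame_op[OF W] q_def)
  then have q_zero: "q i = 0" if "i \<in> I" for i
    using sum_nonneg_eq_0_iff[OF I, of q] q_nonneg sum_nonneg[of I q] that by force
  have proj_zero: "mat_apply (proj n (W i)) x = 0" if i: "i \<in> I" for i
  proof (rule cinner_self_eq_0)
    show "mat_apply (proj n (W i)) x \<in> cspace n"
      by (rule mat_apply_in_cspace[OF proj_carrier[OF W[OF i]]])
    show "cinner n (mat_apply (proj n (W i)) x) (mat_apply (proj n (W i)) x) = 0"
      unfolding cinner_self using q[OF i] q_zero[OF i] by simp
  qed
  have "cinner n w x = 0" if "i \<in> I" "w \<in> W i" for i w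
    using cinner_mat_apply[OF proj_carrier[OF W[OF that(1)]], of w x]
    by (simp add: proj_adjoint proj_zero[OF that(1)] mat_apply_proj[OF W[OF that(1)] that(2)])
  then have "(\<Union>i\<in>I. W i) \<subseteq> {w. cinner n w x = 0}" by blast
  then have "cvec.span (\<Union>i\<in>I. W i) \<subseteq> {w. cinner n w x = 0}"
    by (rule cvec.span_minimal) (simp add: cvec.subspace_def cinner_add_left cinner_scale_left)
  then have "cinner n x x = 0" using x(1) unfolding span by blast
  then show False using x cinner_self_eq_0 by blast
qed

lemma frame_op_eigenvalue_pos:
  assumes W: "\<And>i. i \<in> I \<Longrightarrow> csubspace n (W i)" and I: "finite I"
    and span: "cvec.span (\<Union>i\<in>I. W i) = cspace n"
    and V: "unitary_mat n V" and spec: "frame_op n W I = V * real_diag n \<mu> * V\<^sup>\<dagger>" and j: "j < n"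
  shows "0 < \<mu> j"
proof -
  note V' = unitary_matD(1,2)[OF V]
  define v where "v = mat_apply V (unit_fun j)"
  have e: "unit_fun j \<in> cspace n" by (rule unit_fun_in_cspace[OF j])
  have v: "v \<in> cspace n" unfolding v_def by (rule mat_apply_in_cspace[OF V'(1)])
  have Vv: "mat_apply (V\<^sup>\<dagger>) v = unit_fun j"
    using mat_apply_mult[of "V\<^sup>\<dagger>" V "unit_fun j"] mat_apply_one[OF e] V' by (simp add: v_def)
  have "cinner n v v = cinner n (unit_fun j) (mat_apply (V\<^sup>\<dagger>) v)"
    unfolding v_def by (rule cinner_mat_apply[OF V'(1)])
  also have "\<dots> = (\<Sum>i<n. if i = j then 1 else 0)"
    unfolding Vv cinner_def by (intro sum.cong) (auto simp: unit_fun_def)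
  finally have unit: "cinner n v v = 1" using j by simp
  have diag: "mat_apply (real_diag n \<mu>) (unit_fun j) = cscale (of_real (\<mu> j)) (unit_fun j)"
    using j by (simp add: mat_apply_unit_fun) (auto simp: unit_fun_def fun_eq_iff)
  have "mat_apply (frame_op n W I) v = mat_apply V (mat_apply (real_diag n \<mu>) (mat_apply (V\<^sup>\<dagger>) v))"
    unfolding spec using V'(1) by (simp add: mat_apply_mult)
  also have "\<dots> = cscale (of_real (\<mu> j)) v"
    unfolding Vv diag cpair.linear_scale[OF linear_mat_apply] unfolding v_def ..
  finally have "Re (cinner n (mat_apply (frame_op n W I) v) v) = \<mu> j"
    by (simp add: cinner_scale_left unit del: cscale_apply)
  moreover have "v \<noteq> 0" using unit by auto
  ultimately show ?thesis using frame_op_positive_definite[OF W I span v] by simp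
qed

text \<open>The witness satisfies \<open>T\<^sup>\<dagger> T = \<sigma> F\<^sup>-\<^sup>1\<close> for the frame operator \<open>F\<close>.\<close>

lemma frame_op_scaling:
  assumes W: "\<And>i. i \<in> I \<Longrightarrow> csubspace n (W i)" and I: "finite I"
    and V: "unitary_mat n V" and spec: "frame_op n W I = V * real_diag n \<mu> * V\<^sup>\<dagger>"
    and pos: "\<And>j. j < n \<Longrightarrow> 0 < \<mu> j" "0 < \<sigma>" and slope: "(\<Sum>i\<in>I. real (cvec.dim (W i))) = \<sigma> * real n"
  obtains T where "T \<in> carrier_mat n n" "(cmod (det T))\<^sup>2 = (\<Prod>j<n. \<sigma> / \<mu> j)"
    "(\<Prod>i\<in>I. gram_det n T (W i)) \<le> 1"
proof
  let ?D = "real_diag n (\<lambda>j. sqrt (\<sigma> / \<mu> j))"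
  define T where "T = ?D * V\<^sup>\<dagger>"
  note V_carrier = unitary_matD(1)[OF V]
  show T: "T \<in> carrier_mat n n"
    unfolding T_def using V_carrier by (intro mult_carrier_mat[OF mat_diag_dim]) simp
  have "?D * ?D = real_diag n (\<lambda>j. \<sigma> / \<mu> j)"
    using pos(2) by (intro real_diag_sqrt_squared divide_nonneg_pos pos(1)) simp_all
  then have TT: "T\<^sup>\<dagger> * T = V * real_diag n (\<lambda>j. \<sigma> / \<mu> j) * V\<^sup>\<dagger>"
    unfolding T_def using V_carrier
    by (simp add: mat_adjoint_mult mult_mat_assoc mult_mat_assoc[of ?D ?D, symmetric] del: mat_diag_diag)
  show "(cmod (det T))\<^sup>2 = (\<Prod>j<n. \<sigma> / \<mu> j)"
    using det_gram_square[OF T] unfolding TT det_unitary_conj[OF V mat_diag_dim] det_mat_diag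
    by (simp flip: of_real_divide of_real_prod)
  have "real_diag n (\<lambda>j. \<sigma> / \<mu> j) * real_diag n \<mu> = real_diag n (\<lambda>j. \<sigma>)"
    using pos(1) by (intro eq_matI) (auto simp: less_imp_neq[symmetric])
  then have "T\<^sup>\<dagger> * T * frame_op n W I = V * real_diag n (\<lambda>j. \<sigma>) * V\<^sup>\<dagger>"
    unfolding TT spec mult_unitary_conj[OF V mat_diag_dim mat_diag_dim] by simp
  then have "trace (T\<^sup>\<dagger> * T * frame_op n W I) = of_real (\<sigma> * real n)"
    by (simp add: trace_unitary_conj[OF V] trace_mat_diag mult.commute)
  then have trace: "(\<Sum>i\<in>I. Re (trace (T\<^sup>\<dagger> * T * proj n (W i)))) = \<sigma> * real n"
    using trace_mult_frame_op[where I = I and W = W, OF W, of "T\<^sup>\<dagger> * T"] T by (simp flip: Re_sum)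
  have "(\<Prod>i\<in>I. gram_det n T (W i))
      \<le> (\<Prod>i\<in>I. exp (Re (trace (T\<^sup>\<dagger> * T * proj n (W i))) - real (cvec.dim (W i))))"
    using T W gram_det_le_exp_trace gram_det_nonneg by (intro prod_mono) blast
  also have "\<dots> = exp (\<Sum>i\<in>I. Re (trace (T\<^sup>\<dagger> * T * proj n (W i))) - real (cvec.dim (W i)))"
    by (rule exp_sum[OF I, symmetric])
  also have "\<dots> = 1" by (simp add: sum_subtractf trace slope)
  finally show "(\<Prod>i\<in>I. gram_det n T (W i)) \<le> 1" .
qed

lemma prod_eigenvalues_ge_if_near_optimal:
  assumes W: "\<And>i. i \<in> I \<Longrightarrow> csubspace n (W i)" and I: "finite I"
    and V: "unitary_mat n V" and spec: "frame_op n W I = V * real_diag n \<mu> * V\<^sup>\<dagger>"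
    and pos: "\<And>j. j < n \<Longrightarrow> 0 < \<mu> j" "0 < \<sigma>" and slope: "(\<Sum>i\<in>I. real (cvec.dim (W i))) = \<sigma> * real n"
    and near_optimal: "\<And>T. T \<in> carrier_mat n n \<Longrightarrow> det T \<noteq> 0 \<Longrightarrow>
      (cmod (det T))\<^sup>2 powr \<sigma> \<le> exp (\<sigma> / 4) * (\<Prod>i\<in>I. gram_det n T (W i))"
  shows "exp (- 1 / 4) \<le> (\<Prod>j<n. \<mu> j / \<sigma>)"
proof -
  obtain T where T: "T \<in> carrier_mat n n" "(cmod (det T))\<^sup>2 = (\<Prod>j<n. \<sigma> / \<mu> j)"
    "(\<Prod>i\<in>I. gram_det n T (W i)) \<le> 1"
    by (rule frame_op_scaling[OF W I V spec pos slope]) blast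
  have prod_pos: "0 < (\<Prod>j<n. \<sigma> / \<mu> j)" using pos by (intro prod_pos) simp
  then have "0 < (cmod (det T))\<^sup>2" unfolding T(2) .
  then have "det T \<noteq> 0" by auto
  then have "(\<Prod>j<n. \<sigma> / \<mu> j) powr \<sigma> \<le> exp (\<sigma> / 4) * (\<Prod>i\<in>I. gram_det n T (W i))"
    using near_optimal[OF T(1)] by (simp add: T(2))
  also have "\<dots> \<le> exp (1 / 4) powr \<sigma>" using T(3) by (simp add: powr_def)
  finally have "(\<Prod>j<n. \<sigma> / \<mu> j) \<le> exp (1 / 4)"
    using pos(2) powr_less_mono2[of \<sigma> "exp (1 / 4)"] by (meson exp_ge_zero not_le)
  then have "inverse (exp (1 / 4)) \<le> inverse (\<Prod>j<n. \<sigma> / \<mu> j)"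
    using prod_pos by (rule le_imp_inverse_le)
  then show ?thesis by (simp add: exp_minus[symmetric] prod_inversef[symmetric])
qed

lemma sum_overlaps_le_if_near_optimal:
  assumes W: "\<And>i. i \<in> I \<Longrightarrow> csubspace n (W i)" and I: "finite I"
    and span: "cvec.span (\<Union>i\<in>I. W i) = cspace n"
    and \<sigma>: "0 < \<sigma>" and slope: "(\<Sum>i\<in>I. real (cvec.dim (W i))) = \<sigma> * real n"
    and near_optimal: "\<And>T. T \<in> carrier_mat n n \<Longrightarrow> det T \<noteq> 0 \<Longrightarrow>
      (cmod (det T))\<^sup>2 powr \<sigma> \<le> exp (\<sigma> / 4) * (\<Prod>i\<in>I. gram_det n T (W i))"
  shows "(\<Sum>i\<in>I. \<Sum>j\<in>I. overlap n (W i) (W j)) \<le> 2 * \<sigma>\<^sup>2 * real n"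
proof -
  let ?F = "frame_op n W I"
  obtain V \<mu> where V: "unitary_mat n V" and spec: "?F = V * real_diag n \<mu> * V\<^sup>\<dagger>"
    by (rule spectral_theorem[OF frame_op_carrier frame_op_adjoint[OF W]]) blast
  have \<mu>: "0 < \<mu> j" if "j < n" for j by (rule frame_op_eigenvalue_pos[OF W I span V spec that])
  have "(\<Sum>j<n. \<mu> j) = Re (trace ?F)"
    unfolding spec trace_unitary_conj[OF V mat_diag_dim] trace_mat_diag by simp
  also have "\<dots> = \<sigma> * real n" by (simp add: trace_frame_op[where W = W and I = I, OF W] slope)
  finally have "(\<Sum>j<n. \<mu> j / \<sigma>) = real n" using \<sigma> by (simp add: sum_divide_distrib[symmetric])
  then have "(\<Sum>j<n. (\<mu> j / \<sigma>)\<^sup>2) \<le> 2 * real n"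
    using \<mu> \<sigma> prod_eigenvalues_ge_if_near_optimal[OF W I V spec \<mu> \<sigma> slope near_optimal]
    by (intro sum_squares_le_if_prod_near_one) auto
  then have "(\<Sum>j<n. (\<mu> j)\<^sup>2) \<le> 2 * \<sigma>\<^sup>2 * real n"
    using \<sigma> by (simp add: power_divide sum_divide_distrib[symmetric] field_simps)
  also have "(\<Sum>j<n. (\<mu> j)\<^sup>2) = Re (trace (?F * ?F))"
    unfolding spec mult_unitary_conj[OF V mat_diag_dim mat_diag_dim]
    by (simp add: trace_unitary_conj[OF V] trace_mat_diag power2_eq_square)
  also have "\<dots> = (\<Sum>i\<in>I. \<Sum>j\<in>I. overlap n (W i) (W j))" by (rule trace_frame_op_squared[OF W])
  finally show ?thesis .
qed

context semistable_arrangement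
begin

lemma slope_pos: "0 < \<sigma>"
proof (rule ccontr)
  assume "\<not> 0 < \<sigma>"
  then have "(\<Sum>i\<in>I. real (cvec.dim (W i))) \<le> 0" unfolding slope by (simp add: mult_nonpos_nonneg)
  then have dim: "cvec.dim (W i) = 0" if "i \<in> I" for i
    using that finite_I by (simp add: sum_nonneg_eq_0_iff antisym sum_nonneg flip: of_nat_sum)
  have "W i = {0}" if "i \<in> I" for i
    using subspace_eq_if_dim_le[of "{0}" "W i" d] W[OF that] dim[OF that] cvec.subspace_0 by auto
  then have "(\<Union>i\<in>I. W i) \<subseteq> {0}" by blast
  then have "cspace d \<subseteq> {0}"
    unfolding span_W[symmetric] by (rule cvec.span_minimal) (simp add: cvec.subspace_def)
  then have "unit_fun 0 = 0" using unit_fun_in_cspace[OF d_pos] by blast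
  from fun_cong[OF this, of 0] show False by (simp add: unit_fun_def)
qed

lemma near_optimal_scaling:
  assumes "1 < \<epsilon>"
  obtains C where "C \<in> carrier_mat d d" "det C \<noteq> 0" "\<And>T. T \<in> carrier_mat d d \<Longrightarrow> det T \<noteq> 0 \<Longrightarrow>
    (cmod (det T))\<^sup>2 powr \<sigma> \<le> \<epsilon> * (\<Prod>i\<in>I. gram_det d T (mat_apply C ` W i))"
proof -
  define \<Phi> where "\<Phi> C = (\<Prod>i\<in>I. gram_det d C (W i)) / (cmod (det C))\<^sup>2 powr \<sigma>" for C
  let ?GL = "{C \<in> carrier_mat d d. det C \<noteq> 0}"
  obtain c where c: "0 < c" "\<And>C. C \<in> carrier_mat d d \<Longrightarrow> det C \<noteq> 0 \<Longrightarrow>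
    c * (cmod (det C))\<^sup>2 powr \<sigma> \<le> (\<Prod>i\<in>I. gram_det d C (W i))" by (rule capacity_lower_bound) blast
  have low: "c \<le> \<Phi> C" if "C \<in> ?GL" for C using c(2)[of C] that by (simp add: \<Phi>_def field_simps)
  have "1\<^sub>m d \<in> ?GL" by simp
  then have ne: "?GL \<noteq> {}" by blast
  have bdd: "bdd_below (\<Phi> ` ?GL)" using low by (intro bdd_belowI[of _ c]) blast
  define \<mu> where "\<mu> = (INF C\<in>?GL. \<Phi> C)"
  have "c \<le> \<mu>" unfolding \<mu>_def using low by (intro cINF_greatest[OF ne])
  then have "\<mu> < \<epsilon> * \<mu>" using c(1) assms by simp
  then obtain C where C: "C \<in> ?GL" "\<Phi> C < \<epsilon> * \<mu>" unfolding \<mu>_def cINF_less_iff[OF ne bdd] by blast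
  show ?thesis
  proof (rule that)
    show "C \<in> carrier_mat d d" "det C \<noteq> 0" using C(1) by simp_all
    fix T :: "complex mat" assume T: "T \<in> carrier_mat d d" "det T \<noteq> 0"
    define R where "R = (\<Prod>i\<in>I. gram_det d T (mat_apply C ` W i)) / (cmod (det T))\<^sup>2 powr \<sigma>"
    have "T * C \<in> ?GL" using T C(1) det_mult[of T d C] by simp
    then have "\<mu> \<le> \<Phi> (T * C)" unfolding \<mu>_def by (intro cINF_lower[OF bdd])
    also have "\<dots> = R * \<Phi> C"
      using C(1) T(1) gram_det_mult[OF _ _ T(1) W] det_mult[of T d C]
      by (simp add: \<Phi>_def R_def prod.distrib norm_mult power_mult_distrib powr_mult)
    finally have "\<epsilon> * \<mu> \<le> \<epsilon> * (R * \<Phi> C)" using assms by simp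
    then have "1 * \<Phi> C < (\<epsilon> * R) * \<Phi> C" using C(2) by (simp add: mult.assoc)
    moreover have "0 < \<Phi> C" using low[OF C(1)] c(1) by simp
    ultimately have "1 < \<epsilon> * R" by (simp only: mult_less_cancel_right_pos)
    then show "(cmod (det T))\<^sup>2 powr \<sigma> \<le> \<epsilon> * (\<Prod>i\<in>I. gram_det d T (mat_apply C ` W i))"
      using T(2) by (simp add: R_def field_simps)
  qed
qed

lemma nearly_isotropic_position:
  obtains C where "C \<in> carrier_mat d d" "det C \<noteq> 0"
    "(\<Sum>i\<in>I. \<Sum>j\<in>I. overlap d (mat_apply C ` W i) (mat_apply C ` W j)) \<le> 2 * \<sigma>\<^sup>2 * real d"
proof -
  obtain C where C: "C \<in> carrier_mat d d" "det C \<noteq> 0"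
    and opt: "\<And>T. T \<in> carrier_mat d d \<Longrightarrow> det T \<noteq> 0 \<Longrightarrow>
    (cmod (det T))\<^sup>2 powr \<sigma> \<le> exp (\<sigma> / 4) * (\<Prod>i\<in>I. gram_det d T (mat_apply C ` W i))"
    by (rule near_optimal_scaling[of "exp (\<sigma> / 4)"]) (use slope_pos in auto)
  have "(\<Sum>i\<in>I. \<Sum>j\<in>I. overlap d (mat_apply C ` W i) (mat_apply C ` W j)) \<le> 2 * \<sigma>\<^sup>2 * real d"
  proof (rule sum_overlaps_le_if_near_optimal[OF _ finite_I])
    show "csubspace d (mat_apply C ` W i)" if "i \<in> I" for i
      by (rule csubspace_mat_apply_image[OF C(1) W[OF that]])
    have "cvec.span (\<Union>i\<in>I. mat_apply C ` W i) = mat_apply C ` cspace d"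
      unfolding span_W[symmetric]
      by (simp add: cpair.linear_span_image[OF linear_mat_apply, symmetric] image_UN)
    then show "cvec.span (\<Union>i\<in>I. mat_apply C ` W i) = cspace d"
      using mat_apply_image_cspace[OF C] by simp
    show "(\<Sum>i\<in>I. real (cvec.dim (mat_apply C ` W i))) = \<sigma> * real d"
      unfolding slope[symmetric] using dim_mat_apply_image[OF C W] by simp
  qed (use opt slope_pos in auto)
  then show ?thesis by (rule that[OF C])
qed

end

section \<open>Overlaps along lines\<close>

context
  fixes n :: nat and L :: "'i set" and U :: "'i \<Rightarrow> (nat \<Rightarrow> complex) set"
  assumes finite_L: "finite L" and U: "\<And>a. a \<in> L \<Longrightarrow> csubspace n (U a)"
    and collinear: "\<And>a b c. a \<in> L \<Longrightarrow> b \<in> L \<Longrightarrow> a \<noteq> b \<Longrightarrow> c \<in> L \<Longrightarrow> U c \<subseteq> cvec.span (U a \<union> U b)"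
begin

private abbreviation "total_dim \<equiv> \<Sum>a\<in>L. real (cvec.dim (U a))"
private abbreviation "total_overlap \<equiv> \<Sum>a\<in>L. \<Sum>b\<in>L. overlap n (U a) (U b)"

lemma total_dim_squared_le_pair:
  assumes "a \<in> L" "b \<in> L" "a \<noteq> b"
  shows "total_dim\<^sup>2 \<le> (real (cvec.dim (U a)) + real (cvec.dim (U b))) * total_overlap"
proof -
  let ?Z = "cvec.span (U a \<union> U b)"
  have "U a \<union> U b \<subseteq> cspace n" using U[OF assms(1)] U[OF assms(2)] by blast
  then have Z: "csubspace n ?Z" by (simp add: span_cspace)
  have "total_dim\<^sup>2 \<le> real (cvec.dim ?Z) * total_overlap"
    by (rule sum_dim_squared_le_overlaps[OF U Z collinear[OF assms]])
  also have "\<dots> \<le> (real (cvec.dim (U a)) + real (cvec.dim (U b))) * total_overlap"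
  proof (rule mult_right_mono)
    have "cvec.dim (U a \<union> U b) \<le> cvec.dim (U a) + cvec.dim (U b)"
      using U[OF assms(1)] U[OF assms(2)] by (intro dim_Un_le) auto
    then show "real (cvec.dim ?Z) \<le> real (cvec.dim (U a)) + real (cvec.dim (U b))" by simp
    show "0 \<le> total_overlap" by (intro sum_nonneg overlap_nonneg U)
  qed
  finally show ?thesis .
qed

lemma card_mult_total_dim_le_total_overlap:
  assumes "2 \<le> card L"
  shows "real (card L) * total_dim \<le> 2 * total_overlap"
proof (cases "total_dim = 0")
  case True
  then show ?thesis by (simp add: sum_nonneg overlap_nonneg U)
next
  case False
  define r s Q where "r = real (card L)" and "s = total_dim" and "Q = total_overlap"
  have s: "0 < s" using False unfolding s_def by (metis less_eq_real_def of_nat_0_le_iff sum_nonneg)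
  have r: "2 \<le> r" using assms by (simp add: r_def)
  have card_others: "real (card L - Suc 0) = r - 1" using assms by (simp add: r_def of_nat_diff)
  have "r * (r - 1) * s\<^sup>2 = (\<Sum>a\<in>L. \<Sum>b\<in>L - {a}. s\<^sup>2)"
    by (simp add: card_others r_def)
  also have "\<dots> \<le> (\<Sum>a\<in>L. \<Sum>b\<in>L - {a}. (real (cvec.dim (U a)) + real (cvec.dim (U b))) * Q)"
    unfolding s_def Q_def by (intro sum_mono total_dim_squared_le_pair) auto
  also have "\<dots> = (\<Sum>a\<in>L. (r - 2) * real (cvec.dim (U a)) + s) * Q"
    unfolding sum_distrib_right[symmetric]
    by (intro arg_cong2[where f = "(*)"] sum.cong refl)
      (simp add: sum.distrib sum_diff1 finite_L card_others s_def algebra_simps)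
  also have "(\<Sum>a\<in>L. (r - 2) * real (cvec.dim (U a)) + s) = 2 * (r - 1) * s"
    unfolding sum.distrib sum_distrib_left[symmetric] sum_constant s_def[symmetric] r_def[symmetric]
    by (simp add: algebra_simps)
  finally have "(r - 1) * s * (r * s) \<le> (r - 1) * s * (2 * Q)"
    by (simp add: power2_eq_square mult_ac)
  then show ?thesis using r s by (simp add: mult_le_cancel_left_pos r_def s_def Q_def)
qed

lemma off_diagonal_dim_le_off_diagonal_overlap:
  assumes "3 \<le> card L"
  shows "(\<Sum>a\<in>L. \<Sum>b\<in>L - {a}. real (cvec.dim (U a)) / 4) \<le> (\<Sum>a\<in>L. \<Sum>b\<in>L - {a}. overlap n (U a) (U b))"
proof -
  have "3 * total_dim \<le> real (card L) * total_dim"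
    using assms by (intro mult_right_mono) (auto simp: sum_nonneg)
  moreover have "real (card L) * total_dim \<le> 2 * total_overlap"
    using assms by (intro card_mult_total_dim_le_total_overlap) simp
  ultimately have "(real (card L) - 1) * total_dim / 4 \<le> total_overlap - total_dim"
    by (simp add: field_simps)
  moreover have "(\<Sum>a\<in>L. \<Sum>b\<in>L - {a}. real (cvec.dim (U a)) / 4)
      = (real (card L) - 1) * total_dim / 4"
    using assms by (simp add: of_nat_diff sum_distrib_left sum_divide_distrib)
  moreover have "(\<Sum>a\<in>L. \<Sum>b\<in>L - {a}. overlap n (U a) (U b)) = total_overlap - total_dim"
    by (simp add: sum_diff1 finite_L overlap_self[OF U] sum_subtractf)
  ultimately show ?thesis by simp
qed

end

section \<open>Arrangements of subspaces\<close>

locale subspace_arrangement =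
  fixes I :: "'i set" and V :: "'i \<Rightarrow> (nat \<Rightarrow> complex) set" and k l :: nat
  assumes finite_I: "finite I" and V: "\<And>i. i \<in> I \<Longrightarrow> csubspace l (V i)"
    "\<And>i. i \<in> I \<Longrightarrow> cvec.dim (V i) = k"
    and trivial_Int: "\<And>i j. i \<in> I \<Longrightarrow> j \<in> I \<Longrightarrow> i \<noteq> j \<Longrightarrow> V i \<inter> V j = {0}"
begin

abbreviation X :: "(nat \<Rightarrow> complex) set" where
  "X \<equiv> cvec.span (\<Union>i\<in>I. V i)"

definition line :: "'i \<Rightarrow> 'i \<Rightarrow> 'i set" where
  "line a b = {c \<in> I. V c \<subseteq> cvec.span (V a \<union> V b)}"

definition special_pairs :: "('i \<times> 'i) set" where
  "special_pairs = {(a,b). a \<in> I \<and> b \<in> I - {a} \<and> (\<exists>c\<in>I - {a,b}. c \<in> line a b)}"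

lemma X_cspace: "X \<subseteq> cspace l"
  using V(1) by (intro span_cspace) blast

lemma mem_line: "a \<in> I \<Longrightarrow> b \<in> I \<Longrightarrow> a \<in> line a b \<and> b \<in> line a b"
  using cvec.span_superset[of "V a \<union> V b"] by (auto simp: line_def)

lemma line_eq:
  assumes "a \<in> I" "b \<in> I" "c \<in> line a b" "e \<in> line a b" "c \<noteq> e"
  shows "line c e = line a b"
proof -
  have ce: "c \<in> I" "e \<in> I" using assms(3,4) by (simp_all add: line_def)
  have cspace: "V i \<subseteq> cspace l" if "i \<in> I" for i using V(1)[OF that] by blast
  have "cvec.span (V c \<union> V e) = cvec.span (V a \<union> V b)"
  proof (rule subspace_eq_if_dim_le)
    show "cvec.span (V c \<union> V e) \<subseteq> cvec.span (V a \<union> V b)"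
      using assms(3,4) by (intro cvec.span_minimal) (auto simp: line_def)
    show "cvec.span (V a \<union> V b) \<subseteq> cspace l" using cspace assms(1,2) by (intro span_cspace) blast
    have "cvec.dim (V a \<union> V b) \<le> 2 * k"
      using dim_Un_le[OF cspace[OF assms(1)] cspace[OF assms(2)]] V(2) assms(1,2) by simp
    also have "2 * k = cvec.dim (V c \<union> V e)"
      using dim_Un_eq_if_trivial_Int[OF V(1)[OF ce(1)] V(1)[OF ce(2)] trivial_Int[OF ce assms(5)]]
        V(2) ce by simp
    finally show "cvec.dim (cvec.span (V a \<union> V b)) \<le> cvec.dim (cvec.span (V c \<union> V e))" by simp
  qed simp
  then show ?thesis by (simp add: line_def)
qed

lemma three_le_card_line:
  assumes "(a,b) \<in> special_pairs" shows "3 \<le> card (line a b)"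
proof -
  obtain c where c: "c \<in> I - {a,b}" "c \<in> line a b" "a \<noteq> b"
    using assms by (auto simp: special_pairs_def)
  then have "{a,b,c} \<subseteq> line a b" using assms mem_line[of a b] by (auto simp: special_pairs_def)
  moreover have "finite (line a b)" using finite_I by (simp add: line_def)
  ultimately have "card {a,b,c} \<le> card (line a b)" by (intro card_mono)
  moreover have "card {a,b,c} = 3" using c by auto
  ultimately show ?thesis by simp
qed

lemma special_pair_on_line:
  assumes "(a,b) \<in> special_pairs" "c \<in> line a b" "e \<in> line a b" "c \<noteq> e"
  shows "(c,e) \<in> special_pairs" "line c e = line a b"
proof -
  show eq: "line c e = line a b" using assms line_eq by (auto simp: special_pairs_def)
  have "card {c,e} < card (line a b)"
    using three_le_card_line[OF assms(1)] by (simp add: card_insert_if)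
  then obtain f where "f \<in> line a b" "f \<notin> {c,e}"
    by (metis card_mono finite.emptyI finite.insertI linorder_not_le subsetI)
  moreover have "c \<in> I" "e \<in> I" "f \<in> I" using assms(2,3) calculation(1) by (auto simp: line_def)
  ultimately show "(c,e) \<in> special_pairs" unfolding special_pairs_def using eq assms(4) by blast
qed

lemma sum_special_pairs_by_lines:
  fixes f :: "'i \<Rightarrow> 'i \<Rightarrow> 'a::comm_monoid_add"
  shows "(\<Sum>(a,b)\<in>special_pairs. f a b)
      = (\<Sum>L\<in>case_prod line ` special_pairs. \<Sum>a\<in>L. \<Sum>b\<in>L - {a}. f a b)"
proof -
  have "special_pairs \<subseteq> I \<times> I" by (auto simp: special_pairs_def)
  then have "finite special_pairs" using finite_I finite_subset by blast
  then have "(\<Sum>(a,b)\<in>special_pairs. f a b)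
      = (\<Sum>L\<in>case_prod line ` special_pairs. \<Sum>(a,b)\<in>{p \<in> special_pairs. case_prod line p = L}. f a b)"
    by (rule sum.image_gen)
  also have "\<dots> = (\<Sum>L\<in>case_prod line ` special_pairs. \<Sum>a\<in>L. \<Sum>b\<in>L - {a}. f a b)"
  proof (rule sum.cong[OF refl])
    fix L assume "L \<in> case_prod line ` special_pairs"
    then obtain a b where ab: "(a,b) \<in> special_pairs" "L = line a b" by auto
    have "{p \<in> special_pairs. case_prod line p = L} = Sigma L (\<lambda>c. L - {c})"
    proof (intro equalityI subsetI)
      fix p assume "p \<in> {p \<in> special_pairs. case_prod line p = L}"
      then show "p \<in> Sigma L (\<lambda>c. L - {c})" using mem_line by (auto simp: special_pairs_def)
    next
      fix p assume "p \<in> Sigma L (\<lambda>c. L - {c})"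
      then show "p \<in> {p \<in> special_pairs. case_prod line p = L}"
        using special_pair_on_line[OF ab(1)] ab(2) by auto
    qed
    moreover have "finite L" using finite_I ab(2) by (simp add: line_def)
    ultimately show "(\<Sum>(a,b)\<in>{p \<in> special_pairs. case_prod line p = L}. f a b)
        = (\<Sum>a\<in>L. \<Sum>b\<in>L - {a}. f a b)"
      by (simp add: sum.Sigma)
  qed
  finally show ?thesis .
qed

lemma sum_special_overlaps_ge:
  assumes f: "clinear f" "\<And>i. i \<in> I \<Longrightarrow> csubspace d (f ` V i)"
  shows "(\<Sum>(a,b)\<in>special_pairs. real (cvec.dim (f ` V a)) / 4)
      \<le> (\<Sum>(a,b)\<in>special_pairs. overlap d (f ` V a) (f ` V b))"
  unfolding sum_special_pairs_by_lines
proof (rule sum_mono)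
  fix L assume "L \<in> case_prod line ` special_pairs"
  then obtain a b where ab: "(a,b) \<in> special_pairs" "L = line a b" by auto
  have L: "L \<subseteq> I" unfolding ab(2) line_def by blast
  show "(\<Sum>a\<in>L. \<Sum>b\<in>L - {a}. real (cvec.dim (f ` V a)) / 4)
      \<le> (\<Sum>a\<in>L. \<Sum>b\<in>L - {a}. overlap d (f ` V a) (f ` V b))"
  proof (rule off_diagonal_dim_le_off_diagonal_overlap)
    show "finite L" using L finite_I by (rule finite_subset)
    show "csubspace d (f ` V i)" if "i \<in> L" for i using f(2) L that by blast
    show "3 \<le> card L" unfolding ab(2) by (rule three_le_card_line[OF ab(1)])
    fix c e g assume "c \<in> L" "e \<in> L" "c \<noteq> e" "g \<in> L"
    then have "g \<in> line c e" using special_pair_on_line(2)[OF ab(1)] ab(2) by simp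
    then have "f ` V g \<subseteq> f ` cvec.span (V c \<union> V e)" unfolding line_def by blast
    then show "f ` V g \<subseteq> cvec.span (f ` V c \<union> f ` V e)"
      by (simp add: cpair.linear_span_image[OF f(1), symmetric] image_Un)
  qed
qed

lemma degree_le_slope:
  assumes T: "clinear T" and ss: "semistable_arrangement I (\<lambda>i. T ` V i) d \<sigma>"
    and deg: "\<And>a. a \<in> I \<Longrightarrow> t \<le> real (card {b. (a,b) \<in> special_pairs})"
  shows "t \<le> 8 * \<sigma>"
proof -
  interpret semistable_arrangement I "\<lambda>i. T ` V i" d \<sigma> by (rule ss)
  obtain C where C: "C \<in> carrier_mat d d" "det C \<noteq> 0"
    and iso: "(\<Sum>a\<in>I. \<Sum>b\<in>I. overlap d (mat_apply C ` T ` V a) (mat_apply C ` T ` V b))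
        \<le> 2 * \<sigma>\<^sup>2 * real d"
    by (rule nearly_isotropic_position)
  define f where "f = mat_apply C \<circ> T"
  have f: "clinear f" unfolding f_def by (rule Vector_Spaces.linear_compose[OF T linear_mat_apply])
  have U: "csubspace d (f ` V i)" if "i \<in> I" for i
    unfolding f_def image_comp[symmetric] by (rule csubspace_mat_apply_image[OF C(1) W[OF that]])
  have dim: "cvec.dim (f ` V i) = cvec.dim (T ` V i)" if "i \<in> I" for i
    unfolding f_def image_comp[symmetric] by (rule dim_mat_apply_image[OF C W[OF that]])
  have pairs: "special_pairs = Sigma I (\<lambda>a. {b. (a,b) \<in> special_pairs})"
    "\<And>a. finite {b. (a,b) \<in> special_pairs}"
    using finite_subset[OF _ finite_I] by (auto simp: special_pairs_def)
  have "t * (\<sigma> * real d) / 4 = (\<Sum>a\<in>I. t * (real (cvec.dim (f ` V a)) / 4))"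
    unfolding slope[symmetric] using dim by (simp add: sum_distrib_left sum_divide_distrib)
  also have "\<dots> \<le> (\<Sum>a\<in>I. \<Sum>b\<in>{b. (a,b) \<in> special_pairs}. real (cvec.dim (f ` V a)) / 4)"
    using mult_right_mono[OF deg] by (intro sum_mono) simp
  also have "\<dots> = (\<Sum>(a,b)\<in>special_pairs. real (cvec.dim (f ` V a)) / 4)"
    using finite_I pairs(2) by (subst (2) pairs(1), subst sum.Sigma) auto
  also have "\<dots> \<le> (\<Sum>(a,b)\<in>special_pairs. overlap d (f ` V a) (f ` V b))"
    by (rule sum_special_overlaps_ge[OF f U])
  also have "\<dots> \<le> (\<Sum>(a,b)\<in>I \<times> I. overlap d (f ` V a) (f ` V b))"
    using finite_I U by (intro sum_mono2) (auto simp: special_pairs_def overlap_nonneg)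
  also have "\<dots> \<le> 2 * \<sigma>\<^sup>2 * real d"
    using iso by (simp add: sum.cartesian_product[symmetric] f_def image_comp)
  finally have "(\<sigma> * real d) * t \<le> (\<sigma> * real d) * (8 * \<sigma>)" by (simp add: power2_eq_square mult_ac)
  then show ?thesis using slope_pos d_pos by (simp add: mult_le_cancel_left_pos)
qed

definition quotients :: "(((nat \<Rightarrow> complex) \<Rightarrow> nat \<Rightarrow> complex) \<times> nat) set" where
  "quotients = {(T, d). clinear T \<and> T ` X = cspace d \<and> 0 < d}"

definition quotient_slope :: "((nat \<Rightarrow> complex) \<Rightarrow> nat \<Rightarrow> complex) \<times> nat \<Rightarrow> real" where
  "quotient_slope = (\<lambda>(T, d). (\<Sum>i\<in>I. real (cvec.dim (T ` V i))) / real d)"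

lemma sum_dim_image_le:
  assumes "clinear T" shows "(\<Sum>i\<in>I. cvec.dim (T ` V i)) \<le> card I * k"
  using sum_bounded_above[of I "\<lambda>i. cvec.dim (T ` V i)" k] dim_linear_image_le[OF _ assms] V
  by (metis of_nat_id)

lemma isomorphism_in_quotients:
  assumes "0 < cvec.dim X"
  obtains T where "(T, cvec.dim X) \<in> quotients"
proof -
  have "csubspace l X" "csubspace (cvec.dim X) (cspace (cvec.dim X))"
    using X_cspace by (simp_all add: subspace_cspace)
  then obtain T where "clinear T" "T ` X = cspace (cvec.dim X)"
    by (rule subspace_isomorphism_cspace) (simp_all add: dim_cspace)
  then show ?thesis using that assms by (simp add: quotients_def)
qed

lemma finite_quotient_slopes: "finite (quotient_slope ` quotients)"
proof (rule finite_subset)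
  show "quotient_slope ` quotients \<subseteq> (\<lambda>(a,b). real a / real b) ` ({..card I * k} \<times> {..l})"
  proof (rule image_subsetI, clarify)
    fix T d assume "(T, d) \<in> quotients"
    then have T: "clinear T" "T ` X = cspace d" by (simp_all add: quotients_def)
    have "d \<le> l"
      using dim_linear_image_le[OF X_cspace T(1)] dim_le_cspace[OF X_cspace]
      by (simp add: T(2) dim_cspace)
    then show "quotient_slope (T, d) \<in> (\<lambda>(a,b). real a / real b) ` ({..card I * k} \<times> {..l})"
      using sum_dim_image_le[OF T(1)]
      by (intro image_eqI[of _ _ "(\<Sum>i\<in>I. cvec.dim (T ` V i), d)"]) (auto simp: quotient_slope_def)
  qed
qed simp

lemma least_slope_quotient:
  assumes "0 < cvec.dim X"
  obtains T d where "(T, d) \<in> quotients"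
    "\<And>S m. (S, m) \<in> quotients \<Longrightarrow> quotient_slope (T, d) \<le> quotient_slope (S, m)"
proof -
  have "quotient_slope ` quotients \<noteq> {}" using isomorphism_in_quotients[OF assms] by blast
  then have "Min (quotient_slope ` quotients) \<in> quotient_slope ` quotients"
    by (rule Min_in[OF finite_quotient_slopes])
  then obtain T d where "(T, d) \<in> quotients"
    "quotient_slope (T, d) = Min (quotient_slope ` quotients)"
    by (metis imageE surj_pair)
  then show ?thesis using that[of T d] finite_quotient_slopes by simp
qed

text \<open>As in the construction of Harder-Narasimhan filtrations.\<close>

lemma semistable_if_least_slope:
  assumes quotient: "(T, d) \<in> quotients"
    and least: "\<And>S m. (S, m) \<in> quotients \<Longrightarrow> quotient_slope (T, d) \<le> quotient_slope (S, m)"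
  shows "semistable_arrangement I (\<lambda>i. T ` V i) d (quotient_slope (T, d))"
proof
  have T: "clinear T" "T ` X = cspace d" "0 < d" using quotient by (simp_all add: quotients_def)
  show "finite I" "0 < d" by (fact finite_I, fact T(3))
  show "csubspace d (T ` V i)" if "i \<in> I" for i
    using cpair.linear_subspace_image[OF T(1)] V(1)[OF that] cvec.span_superset[of "\<Union>i\<in>I. V i"] T(2)
      that by blast
  show "cvec.span (\<Union>i\<in>I. T ` V i) = cspace d"
    using cpair.linear_span_image[OF T(1), of "\<Union>i\<in>I. V i"] T(2) by (simp add: image_UN)
  show "(\<Sum>i\<in>I. real (cvec.dim (T ` V i))) = quotient_slope (T, d) * real d"
    using T(3) by (simp add: quotient_slope_def)
  show "quotient_slope (T, d) * real m \<le> (\<Sum>i\<in>I. real (cvec.dim (S ` T ` V i)))"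
    if S: "clinear S" "S ` cspace d = cspace m" for S m
  proof (cases "m = 0")
    case False
    have "(S \<circ> T) ` X = cspace m" unfolding image_comp[symmetric] T(2) by (rule S(2))
    then have "(S \<circ> T, m) \<in> quotients"
      using Vector_Spaces.linear_compose[OF T(1) S(1)] False by (simp add: quotients_def)
    from least[OF this] have "quotient_slope (T, d)
        \<le> (\<Sum>i\<in>I. real (cvec.dim (S ` T ` V i))) / real m"
      by (simp add: quotient_slope_def image_comp)
    then show ?thesis using False by (simp add: field_simps)
  qed (simp add: sum_nonneg)
qed

lemma semistable_quotient:
  assumes pos: "0 < cvec.dim X"
  obtains T d \<sigma> where "clinear T" "semistable_arrangement I (\<lambda>i. T ` V i) d \<sigma>"
    "\<sigma> * real (cvec.dim X) \<le> real (card I) * real k"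
proof -
  obtain T d where T: "(T, d) \<in> quotients"
    and least: "\<And>S m. (S, m) \<in> quotients \<Longrightarrow> quotient_slope (T, d) \<le> quotient_slope (S, m)"
    by (rule least_slope_quotient[OF pos]) blast
  obtain S where S: "(S, cvec.dim X) \<in> quotients" by (rule isomorphism_in_quotients[OF pos])
  have "quotient_slope (T, d) * real (cvec.dim X)
      \<le> quotient_slope (S, cvec.dim X) * real (cvec.dim X)"
    by (intro mult_right_mono least[OF S]) simp
  also have "\<dots> = real (\<Sum>i\<in>I. cvec.dim (S ` V i))" using pos by (simp add: quotient_slope_def)
  also have "\<dots> \<le> real (card I * k)"
    using S by (intro of_nat_mono sum_dim_image_le) (simp add: quotients_def)
  finally have "quotient_slope (T, d) * real (cvec.dim X) \<le> real (card I) * real k" by simp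
  moreover have "clinear T" using T by (simp add: quotients_def)
  ultimately show ?thesis using that semistable_if_least_slope[OF T least] by blast
qed

lemma dim_span_le:
  assumes deg: "\<And>a. a \<in> I \<Longrightarrow> \<delta> * real (card I) \<le> real (card {b. (a,b) \<in> special_pairs})"
  shows "\<delta> * real (cvec.dim X) \<le> 8 * real k"
proof (cases "cvec.dim X = 0")
  case False
  then obtain T d \<sigma> where T: "clinear T" "semistable_arrangement I (\<lambda>i. T ` V i) d \<sigma>"
    and \<sigma>: "\<sigma> * real (cvec.dim X) \<le> real (card I) * real k"
    using semistable_quotient by blast
  have "I \<noteq> {}" using False cvec.dim_eq_card_independent[OF cvec.independent_empty] by auto
  then have card: "0 < real (card I)" using finite_I by (simp add: card_gt_0_iff)
  have "\<delta> * real (card I) \<le> 8 * \<sigma>" by (rule degree_le_slope[OF T deg])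
  then have "\<delta> * real (card I) * real (cvec.dim X) \<le> 8 * \<sigma> * real (cvec.dim X)"
    by (rule mult_right_mono) simp
  also have "\<dots> \<le> 8 * (real (card I) * real k)" using \<sigma> by simp
  finally have "real (card I) * (\<delta> * real (cvec.dim X)) \<le> real (card I) * (8 * real k)"
    by (simp add: mult_ac)
  then show ?thesis using card by (simp add: mult_le_cancel_left_pos)
qed simp

lemma degree_density_le_1:
  assumes "I \<noteq> {}"
    and deg: "\<And>a. a \<in> I \<Longrightarrow> \<delta> * real (card I) \<le> real (card {b. (a,b) \<in> special_pairs})"
  shows "\<delta> \<le> 1"
proof -
  obtain a where "a \<in> I" using assms(1) by blast
  have "{b. (a,b) \<in> special_pairs} \<subseteq> I" unfolding special_pairs_def by blast
  then have "real (card {b. (a,b) \<in> special_pairs}) \<le> real (card I)"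
    by (intro of_nat_mono card_mono finite_I)
  then have "\<delta> * real (card I) \<le> 1 * real (card I)" using deg[OF \<open>a \<in> I\<close>] by simp
  then show ?thesis using assms(1) finite_I by (simp add: card_gt_0_iff mult_le_cancel_right_pos)
qed

end

theorem theorem2:
  "\<exists>C::real. C > 0 \<and>
    (\<forall>(k::nat) (n::nat) (l::nat) (\<delta>::real) (V :: nat \<Rightarrow> (nat \<Rightarrow> complex) set).
      k > 0 \<longrightarrow> n > 0 \<longrightarrow> l > 0 \<longrightarrow> \<delta> > 0 \<longrightarrow>
      (\<forall>i\<in>{1..n}. cvec.subspace (V i) \<and> V i \<subseteq> cspace l \<and> cvec.dim (V i) = k) \<longrightarrow>
      (\<forall>i\<in>{1..n}. \<forall>i'\<in>{1..n}. i \<noteq> i' \<longrightarrow> V i \<inter> V i' = {0}) \<longrightarrow>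
      (\<forall>i1\<in>{1..n}.
         real (card {i2 \<in> {1..n} - {i1}.
                 \<exists>i3\<in>{1..n} - {i1, i2}. V i3 \<subseteq> cvec.span (V i1 \<union> V i2)}) \<ge> \<delta> * real n) \<longrightarrow>
      real (cvec.dim (cvec.span (\<Union>i\<in>{1..n}. V i))) \<le> C * real k ^ 4 / \<delta>\<^sup>2)"
proof (intro exI[of _ 8] conjI allI impI)
  fix k n l :: nat and \<delta> :: real and V :: "nat \<Rightarrow> (nat \<Rightarrow> complex) set"
  assume pos: "k > 0" "n > 0" "l > 0" "\<delta> > 0"
    and V: "\<forall>i\<in>{1..n}. cvec.subspace (V i) \<and> V i \<subseteq> cspace l \<and> cvec.dim (V i) = k"
      "\<forall>i\<in>{1..n}. \<forall>i'\<in>{1..n}. i \<noteq> i' \<longrightarrow> V i \<inter> V i' = {0}"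
    and many: "\<forall>i1\<in>{1..n}. real (card {i2 \<in> {1..n} - {i1}.
        \<exists>i3\<in>{1..n} - {i1, i2}. V i3 \<subseteq> cvec.span (V i1 \<union> V i2)}) \<ge> \<delta> * real n"
  let ?D = "real (cvec.dim (cvec.span (\<Union>i\<in>{1..n}. V i)))"
  interpret subspace_arrangement "{1..n}" V k l using V by unfold_locales auto
  have deg: "\<delta> * real (card {1..n}) \<le> real (card {b. (a,b) \<in> special_pairs})" if "a \<in> {1..n}" for a
  proof -
    have "{b. (a,b) \<in> special_pairs}
        = {b \<in> {1..n} - {a}. \<exists>c\<in>{1..n} - {a,b}. V c \<subseteq> cvec.span (V a \<union> V b)}"
      using that unfolding special_pairs_def line_def by blast
    then show ?thesis using many that by simp
  qed
  have "\<delta> * (\<delta> * ?D) \<le> 1 * (\<delta> * ?D)"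
    using pos degree_density_le_1[OF _ deg] by (intro mult_right_mono) auto
  also have "\<dots> \<le> 8 * real k" using dim_span_le[OF deg] by simp
  also have "\<dots> \<le> 8 * real k ^ 4" using pos power_increasing[of 1 4 "real k"] by simp
  finally show "?D \<le> 8 * real k ^ 4 / \<delta>\<^sup>2" using pos by (simp add: field_simps power2_eq_square)
qed simp

end
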